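(* Let $d,n\ge 1$, let $A$ be a non-singular real $d\times d$ matrix, let $\boldsymbol B(t)$, $t\ge0$, be a $d$-dimensional Brownian motion with independent standard Brownian motion components, let $\boldsymbol Z(t)=A\boldsymbol B(t)$, $t\ge 0$, and let $\boldsymbol Z_1,\dots,\boldsymbol Z_n$ be independent copies of the process $\boldsymbol Z$. Let $T_1,\dots,T_n>0$, and for each $k\in\{1,\dots,n\}$ let $\boldsymbol c_k:[0,\infty)\to\mathbb{R}^d$ be a continuous function for which there is $M_k>0$ with $|c_{k,i}(t)-c_{k,i}(T_k)|\le M_k|t-T_k|^{1/2}$ for all $t\in[0,T_k]$ and all $i\in\{1,\dots,d\}$, where $c_{k,i}$ is the $i$-th component of $\boldsymbol c_k$. Let $\boldsymbol S\subset\mathbb{R}^d$ be a closed set with $\boldsymbol 0\notin\boldsymbol S$ that satisfies the cone condition with respect to $\boldsymbol Z$, and let $\varepsilon_{\boldsymbol S}$ be any function as in the definition of the cone condition. For $\boldsymbol t=(t_1,\dots,t_n)$ put $$\boldsymbol Z(\boldsymbol t)=\sum_{k=1}^n\boldsymbol Z_k(t_k),\qquad \boldsymbol c(\boldsymbol t)=\sum_{k=1}^n\boldsymbol c_k(t_k),$$ and let $\boldsymbol T=(T_1,\dots,T_n)$, $\mathbb{T}=[0,T_1]\times\dots\times[0,T_n]$. For $k\in\{1,\dots,n\}$ set $$\mathfrak{C}_k(T_k)=\inf_{t\in[0,T_k)}\exp\left(-T_k\left(\frac{\boldsymbol c_k(T_k)-\boldsymbol c_k(t)}{\sqrt{T_k-t}}\right)^{\top}\Sigma^{-1}(T_k)\left(\frac{\boldsymbol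 c_k(T_k)-\boldsymbol c_k(t)}{\sqrt{T_k-t}}\right)\right),$$ where $\Sigma(T_k)$ is the covariance matrix of $\boldsymbol Z(T_k)=A\boldsymbol B(T_k)$ and $\Sigma^{-1}(T_k)$ its inverse. Then $\mathfrak{C}_k(T_k)>0$ for all $k$, and for all $u>1$ $$\mathbb{P}\{\boldsymbol Z(\boldsymbol T)-\boldsymbol c(\boldsymbol T)\in u\boldsymbol S\}\le\mathbb{P}\{\exists\,\boldsymbol t\in\mathbb{T}:\ \boldsymbol Z(\boldsymbol t)-\boldsymbol c(\boldsymbol t)\in u\boldsymbol S\}\le\left(\prod_{k=1}^n\frac{2^{d/2}}{\mathfrak{C}_k(T_k)\,\varepsilon_{\boldsymbol S}(T_k)}\right)\mathbb{P}\{\boldsymbol Z(\boldsymbol T)-\boldsymbol c(\boldsymbol T)\in u\boldsymbol S\}.$$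
   Context: For $\boldsymbol S\subset\mathbb{R}^d$ and $u>0$, $u\boldsymbol S=\{u\boldsymbol x:\boldsymbol x\in\boldsymbol S\}$, and $\boldsymbol V-\boldsymbol x=\{\boldsymbol v-\boldsymbol x:\boldsymbol v\in\boldsymbol V\}$. Cone condition: a closed set $\boldsymbol S\subset\mathbb{R}^d$ satisfies the cone condition with respect to the process $\boldsymbol Z(t)=A\boldsymbol B(t)$, $t\ge 0$, if there exists a strictly positive function $\varepsilon_{\boldsymbol S}(t)$, $t>0$, such that for every $\boldsymbol x\in\boldsymbol S$ there is a Borel set $\boldsymbol V_{\boldsymbol x}\subset\boldsymbol S$, not depending on $t$, with $\boldsymbol x\in \boldsymbol V_{\boldsymbol x}$, with $\boldsymbol V_{\boldsymbol x}-\boldsymbol x\subset C(\boldsymbol V_{\boldsymbol x}-\boldsymbol x)$ for all $C>1$, and with $\mathbb{P}\{\boldsymbol Z(t)\in\boldsymbol V_{\boldsymbol x}-\boldsymbol x\}\ge\varepsilon_{\boldsymbol S}(t)$ for all $t>0$. *)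

theory Defs
  imports "HOL-Probability.Probability"
begin

text \<open>
  Processes are functions \<open>real \<Rightarrow> 'a \<Rightarrow> _\<close> of which only the times \<open>t \<ge> 0\<close> matter; the
  initial value and path continuity are required almost surely.
\<close>

locale std_brownian_motion = prob_space M for M :: "'a measure" +
  fixes W :: "real \<Rightarrow> 'a \<Rightarrow> real"
  assumes rv: "\<And>t. 0 \<le> t \<Longrightarrow> random_variable borel (W t)"
    and start: "AE \<omega> in M. W 0 \<omega> = 0"
    and normal_increments: "\<And>s t. 0 \<le> s \<Longrightarrow> s < t \<Longrightarrow>
      distributed M lborel (\<lambda>\<omega>. W t \<omega> - W s \<omega>) (normal_density 0 (sqrt (t - s)))"
    and indep_increments: "\<And>(s :: nat \<Rightarrow> real) m. 0 \<le> s 0 \<Longrightarrow> strict_mono s \<Longrightarrow>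
      indep_vars (\<lambda>_. borel) (\<lambda>i \<omega>. W (s (Suc i)) \<omega> - W (s i) \<omega>) {..<m}"
    and continuous_paths: "AE \<omega> in M. continuous_on {0..} (\<lambda>t. W t \<omega>)"

definition path_space :: "(real \<Rightarrow> 'b::topological_space) measure" where
  "path_space = PiM {0..} (\<lambda>_. borel)"

definition path :: "(real \<Rightarrow> 'a \<Rightarrow> 'b) \<Rightarrow> 'a \<Rightarrow> real \<Rightarrow> 'b" where
  "path X \<omega> = (\<lambda>t\<in>{0..}. X t \<omega>)"

locale brownian_motion = prob_space M for M :: "'a measure" +
  fixes B :: "real \<Rightarrow> 'a \<Rightarrow> real ^ 'd"
  assumes components: "\<And>i. std_brownian_motion M (\<lambda>t \<omega>. B t \<omega> $ i)"
    and indep_components: "indep_vars (\<lambda>_. path_space) (\<lambda>i. path (\<lambda>t \<omega>. B t \<omega> $ i)) UNIV"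

text \<open>
  Path continuity is listed separately because the law on the product sigma-algebra
  determines only the finite-dimensional distributions.
\<close>

definition indep_copies ::
  "'a measure \<Rightarrow> (real \<Rightarrow> 'a \<Rightarrow> real ^ 'd) \<Rightarrow> 'k set \<Rightarrow> ('k \<Rightarrow> real \<Rightarrow> 'a \<Rightarrow> real ^ 'd) \<Rightarrow> bool"
where
  "indep_copies M Z I Zs \<longleftrightarrow>
     prob_space.indep_vars M (\<lambda>_. path_space) (\<lambda>k. path (Zs k)) I \<and>
     (\<forall>k\<in>I. distr M path_space (path (Zs k)) = distr M path_space (path Z)) \<and>
     (\<forall>k\<in>I. AE \<omega> in M. continuous_on {0..} (\<lambda>t. Zs k t \<omega>))"

definition cone_condition_with ::
  "'a measure \<Rightarrow> (real \<Rightarrow> 'a \<Rightarrow> real ^ 'd) \<Rightarrow> (real ^ 'd) set \<Rightarrow> (real \<Rightarrow> real) \<Rightarrow> bool"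
where
  "cone_condition_with M Z S \<epsilon> \<longleftrightarrow>
     (\<forall>t>0. \<epsilon> t > 0) \<and>
     (\<forall>x\<in>S. \<exists>V\<in>sets borel. V \<subseteq> S \<and> x \<in> V \<and>
        (\<forall>C>1. (\<lambda>v. v - x) ` V \<subseteq> (*\<^sub>R) C ` (\<lambda>v. v - x) ` V) \<and>
        (\<forall>t>0. measure M {\<omega> \<in> space M. Z t \<omega> \<in> (\<lambda>v. v - x) ` V} \<ge> \<epsilon> t))"

definition covariance_matrix :: "'a measure \<Rightarrow> ('a \<Rightarrow> real ^ 'd) \<Rightarrow> real ^ 'd ^ 'd" where
  "covariance_matrix M X =
     (\<chi> i j. LINT \<omega>|M. (X \<omega> $ i - (LINT \<omega>'|M. X \<omega>' $ i)) * (X \<omega> $ j - (LINT \<omega>'|M. X \<omega>' $ j)))"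

definition drift_constant ::
  "'a measure \<Rightarrow> (real \<Rightarrow> 'a \<Rightarrow> real ^ 'd) \<Rightarrow> (real \<Rightarrow> real ^ 'd) \<Rightarrow> real \<Rightarrow> real"
where
  "drift_constant M Z c T =
     (INF t\<in>{0..<T}.
        let q = (c T - c t) /\<^sub>R sqrt (T - t)
        in exp (- T * (q \<bullet> (matrix_inv (covariance_matrix M (Z T)) *v q))))"

end

theory Submission
  imports Defs
begin

text \<open>
  Discretise time and thicken the target to \<open>uS\<close> plus a closed \<open>\<delta>\<close>-ball. For one process on a grid,
  decompose according to the first hitting time \<open>t\<close>: the increment over \<open>[t, T]\<close> is independent of
  the past, and with conditional probability at least the inverse of the constant it carries the
  process from a point of the target into the translated cone contained in the target. This lower
  bound compares a shifted Gaussian density with the centred one of half the variance, via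
  \<open>\<bar>h + b\<bar>\<^sup>2 \<le> 2\<bar>h\<bar>\<^sup>2 + 2\<bar>b\<bar>\<^sup>2\<close>, which produces the factor \<open>2\<^bsup>d/2\<^esup>\<close> and the exponential in the
  drift constant. Since the hypothesis on the target survives finite unions of translates, Fubini
  replaces the times of the \<open>n\<close> independent processes by their end points one at a time. Finally the
  grid is refined by path continuity and \<open>\<delta>\<close> tends to 0.
\<close>

subsection \<open>Comparison of product measures\<close>

text \<open>On a grid the first hitting index takes finitely many values, so independence of
  increments does the work of a strong Markov property. The price is that a path may meet
  \<open>uS\<close> strictly between grid points, where the grid misses it; thickening pays this
  price, since by continuity a fine grid sees every neighbourhood of a hit. The cone hypothesis
  survives thickening because a cone attached to x in \<open>uS\<close> can be carried along by any
  vector of the ball. The hypothesis passes to unions because it only asks for some set at each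
  point. Halving the variance makes room for the drift. It replaces the increment over [t, T] by B T
  / r plus a shift that cancels the drift, with r = sqrt (2 T / (T - t)). As r u > 1, a cone shrunk
  by this factor stays inside itself, so the single bound at the end time serves every t.\<close>

lemma (in prob_space) indep_var_emeasure_ge:
  assumes ind: "indep_var N X N' Y"
    and E: "E \<in> sets N" and R: "{x \<in> space (N \<Otimes>\<^sub>M N'). Q (fst x) (snd x)} \<in> sets (N \<Otimes>\<^sub>M N')"
    and ge: "\<And>x. x \<in> E \<Longrightarrow> \<kappa> \<le> emeasure M {\<omega> \<in> space M. Q x (Y \<omega>)}"
  shows "\<kappa> * emeasure M {\<omega> \<in> space M. X \<omega> \<in> E}
    \<le> emeasure M {\<omega> \<in> space M. X \<omega> \<in> E \<and> Q (X \<omega>) (Y \<omega>)}"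
proof -
  have rv [measurable]: "random_variable N X" "random_variable N' Y"
    and dist: "distr M N X \<Otimes>\<^sub>M distr M N' Y = distr M (N \<Otimes>\<^sub>M N') (\<lambda>\<omega>. (X \<omega>, Y \<omega>))"
    using indep_var_distribution_eq[THEN iffD1, OF ind] by auto
  interpret Y: prob_space "distr M N' Y" by (rule prob_space_distr) simp
  let ?R = "{x \<in> space (N \<Otimes>\<^sub>M N'). Q (fst x) (snd x)}"
  \<comment> \<open>Cutting down to \<open>E\<close> empties the sections over points where no lower
    bound is available. By independence the joint law is a product, so the measure of
    \<open>?D\<close> is the integral of its sections.\<close>
  let ?D = "?R \<inter> (E \<times> space N')"
  have D: "?D \<in> sets (N \<Otimes>\<^sub>M N')"
    by (intro sets.Int R pair_measureI E sets.top)
  have sp: "X \<omega> \<in> space N" "Y \<omega> \<in> space N'" if "\<omega> \<in> space M" for \<omega>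
    using measurable_space[OF rv(1) that] measurable_space[OF rv(2) that] by auto
  have "\<kappa> * emeasure M {\<omega> \<in> space M. X \<omega> \<in> E} = (\<integral>\<^sup>+x. \<kappa> * indicator E x \<partial>distr M N X)"
    using E by (simp add: nn_integral_cmult emeasure_distr vimage_def Int_def conj_commute)
  also have "\<dots> \<le> (\<integral>\<^sup>+x. emeasure (distr M N' Y) (Pair x -` ?D) \<partial>distr M N X)"
  proof (rule nn_integral_mono)
    fix x
    show "\<kappa> * indicator E x \<le> emeasure (distr M N' Y) (Pair x -` ?D)"
    proof (cases "x \<in> E")
      case True
      have "emeasure (distr M N' Y) (Pair x -` ?D) = emeasure M (Y -` (Pair x -` ?D) \<inter> space M)"
        using sets_Pair1[OF D] by (simp add: emeasure_distr)
      also have "Y -` (Pair x -` ?D) \<inter> space M = {\<omega> \<in> space M. Q x (Y \<omega>)}"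
        using True E[THEN sets.sets_into_space] sp by (auto simp: space_pair_measure)
      finally show ?thesis using ge[OF True] True by simp
    qed simp
  qed
  also have "\<dots> = emeasure (distr M N X \<Otimes>\<^sub>M distr M N' Y) ?D"
    using D by (intro Y.emeasure_pair_measure_alt[symmetric]) simp
  also have "\<dots> = emeasure M ((\<lambda>\<omega>. (X \<omega>, Y \<omega>)) -` ?D \<inter> space M)"
    unfolding dist using D by (intro emeasure_distr) simp_all
  also have "(\<lambda>\<omega>. (X \<omega>, Y \<omega>)) -` ?D \<inter> space M = {\<omega> \<in> space M. X \<omega> \<in> E \<and> Q (X \<omega>) (Y \<omega>)}"
    using sp by (auto simp: space_pair_measure)
  finally show ?thesis .
qed

text \<open>One coordinate is exchanged at a time. The hypothesis ranges over all measurable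
  integrands because freezing the other coordinates of \<open>f\<close> leaves an arbitrary function
  of the remaining one.\<close>

lemma nn_integral_PiM_mono:
  fixes N N' :: "'i \<Rightarrow> 'b measure"
  assumes sf: "\<And>i. sigma_finite_measure (N i)" "\<And>i. sigma_finite_measure (N' i)"
    and sets: "\<And>i. sets (N' i) = sets (N i)"
    and le: "\<And>i g. i \<in> I \<Longrightarrow> g \<in> borel_measurable (N i) \<Longrightarrow>
      k i * (\<integral>\<^sup>+x. g x \<partial>N' i) \<le> (\<integral>\<^sup>+x. g x \<partial>N i)"
    and "finite I" and "f \<in> borel_measurable (PiM I N)"
  shows "(\<Prod>i\<in>I. k i) * (\<integral>\<^sup>+x. f x \<partial>PiM I N') \<le> (\<integral>\<^sup>+x. f x \<partial>PiM I N)"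
  using \<open>finite I\<close> \<open>f \<in> borel_measurable (PiM I N)\<close> le
proof (induction I arbitrary: f rule: finite_induct)
  case empty
  interpret P: product_sigma_finite N by (rule product_sigma_finite.intro) (rule sf)
  interpret P': product_sigma_finite N' by (rule product_sigma_finite.intro) (rule sf)
  show ?case by (simp add: P.nn_integral_empty P'.nn_integral_empty)
next
  case (insert i I)
  interpret P: product_sigma_finite N by (rule product_sigma_finite.intro) (rule sf)
  interpret P': product_sigma_finite N' by (rule product_sigma_finite.intro) (rule sf)
  have f [measurable]: "f \<in> borel_measurable (PiM (insert i I) N)" by fact
  have setsP: "sets (PiM J N') = sets (PiM J N)" for J
    by (rule sets_PiM_cong) (simp_all add: sets)
  have f': "f \<in> borel_measurable (PiM (insert i I) N')"
    using f by (simp add: measurable_cong_sets[OF setsP refl])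
  have upd: "(\<lambda>y. f (x(i := y))) \<in> borel_measurable (N i)" if "x \<in> space (PiM I N)" for x
    using that insert(2) by measurable
  have m: "(\<lambda>x. \<integral>\<^sup>+y. f (x(i := y)) \<partial>N' i) \<in> borel_measurable (PiM I N)"
  proof (rule sigma_finite_measure.borel_measurable_nn_integral[OF sf(2)])
    have "(\<lambda>(x, y). f (x(i := y))) \<in> borel_measurable (PiM I N \<Otimes>\<^sub>M N i)" by measurable
    then show "(\<lambda>(x, y). f (x(i := y))) \<in> borel_measurable (PiM I N \<Otimes>\<^sub>M N' i)"
      by (simp add: measurable_cong_sets[OF sets_pair_measure_cong[OF refl sets] refl])
  qed
  have sp: "space (PiM I N') = space (PiM I N)" using setsP by (rule sets_eq_imp_space_eq)
  have "(\<Prod>j\<in>insert i I. k j) * (\<integral>\<^sup>+x. f x \<partial>PiM (insert i I) N')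
      = k i * ((\<Prod>j\<in>I. k j) * (\<integral>\<^sup>+x. \<integral>\<^sup>+y. f (x(i := y)) \<partial>N' i \<partial>PiM I N'))"
    using insert(1,2) by (simp add: P'.product_nn_integral_insert[OF insert(1,2) f'] mult_ac)
  \<comment> \<open>The induction hypothesis acts on the outer integral, whose integrand is the
    inner integral against \<open>N' i\<close>; the bound for \<open>i\<close> then acts
    inside.\<close>
  also have "\<dots> \<le> k i * (\<integral>\<^sup>+x. \<integral>\<^sup>+y. f (x(i := y)) \<partial>N' i \<partial>PiM I N)"
    using insert.prems by (intro mult_left_mono insert.IH m) auto
  also have "\<dots> = (\<integral>\<^sup>+x. k i * (\<integral>\<^sup>+y. f (x(i := y)) \<partial>N' i) \<partial>PiM I N)"
    by (rule nn_integral_cmult[symmetric]) (rule m)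
  also have "\<dots> \<le> (\<integral>\<^sup>+x. \<integral>\<^sup>+y. f (x(i := y)) \<partial>N i \<partial>PiM I N)"
    by (intro nn_integral_mono insert.prems(2) upd) auto
  also have "\<dots> = (\<integral>\<^sup>+x. f x \<partial>PiM (insert i I) N)"
    by (rule P.product_nn_integral_insert[OF insert(1,2) f, symmetric])
  finally show ?case .
qed

text \<open>The affine map turns N(0, T) into N(b, \<tau>/2), whose density times exp(-b^2/\<tau>) /
  sqrt 2 lies below that of N(0, \<tau>). Here sqrt 2 is the ratio of the normalising constants and
  the exponential is the cost of the shift.\<close>

lemma normal_affine_nn_integral_le:
  fixes f :: "real \<Rightarrow> ennreal"
  assumes f [measurable]: "f \<in> borel_measurable borel" and "0 < \<tau>" "0 < T"
  shows "ennreal (exp (- b\<^sup>2 / \<tau>) / sqrt 2)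
      * (\<integral>\<^sup>+x. f (sqrt (\<tau> / (2 * T)) * x + b) \<partial>density lborel (normal_density 0 (sqrt T)))
    \<le> (\<integral>\<^sup>+x. f x \<partial>density lborel (normal_density 0 (sqrt \<tau>)))"
proof -
  define r where "r = sqrt (\<tau> / (2 * T))"
  have r: "r > 0" "r\<^sup>2 = \<tau> / (2 * T)" using assms by (auto simp: r_def)
  have dens: "exp (- b\<^sup>2 / \<tau>) / sqrt 2 * normal_density 0 (sqrt T) x
      \<le> r * normal_density 0 (sqrt \<tau>) (b + r * x)" for x
  proof -
    \<comment> \<open>After division by 2 \<tau> the second term is x^2 / (2 T), the exponent of
      N(0, T), because r^2 / \<tau> = 1 / (2 T); the first term leaves b^2 / \<tau>.\<close>
    have "(b + r * x)\<^sup>2 \<le> 2 * b\<^sup>2 + 2 * (r * x)\<^sup>2"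
      using zero_le_power2[of "b - r * x"] by (simp add: power2_eq_square algebra_simps)
    then have "(b + r * x)\<^sup>2 / (2 * \<tau>) \<le> (2 * b\<^sup>2 + 2 * (r * x)\<^sup>2) / (2 * \<tau>)"
      using assms by (intro divide_right_mono) auto
    also have "\<dots> = b\<^sup>2 / \<tau> + x\<^sup>2 / (2 * T)"
      using assms by (simp add: power_mult_distrib r field_simps)
    finally have "exp (- b\<^sup>2 / \<tau>) * exp (- x\<^sup>2 / (2 * T)) \<le> exp (- (b + r * x)\<^sup>2 / (2 * \<tau>))"
      by (simp flip: exp_add)
    moreover have "r / sqrt (2 * pi * \<tau>) = 1 / sqrt 2 / sqrt (2 * pi * T)"
      using assms by (simp add: r_def real_sqrt_mult real_sqrt_divide field_simps)
    moreover have "1 / sqrt 2 / sqrt (2 * pi * T) \<ge> 0" using assms by simp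
    ultimately have "1 / sqrt 2 / sqrt (2 * pi * T) * (exp (- b\<^sup>2 / \<tau>) * exp (- x\<^sup>2 / (2 * T)))
        \<le> r / sqrt (2 * pi * \<tau>) * exp (- (b + r * x)\<^sup>2 / (2 * \<tau>))"
      by (metis mult_left_mono)
    then show ?thesis using assms by (simp add: normal_density_def mult_ac)
  qed
  let ?k = "exp (- b\<^sup>2 / \<tau>) / sqrt 2"
  have nk: "ennreal (?k * normal_density 0 (sqrt T) x) = ennreal ?k * ennreal (normal_density 0 (sqrt T) x)" for x
    by (rule ennreal_mult') simp
  have "ennreal ?k * (\<integral>\<^sup>+x. f (r * x + b) \<partial>density lborel (normal_density 0 (sqrt T)))
      = (\<integral>\<^sup>+x. ennreal (?k * normal_density 0 (sqrt T) x) * f (b + r * x) \<partial>lborel)"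
    unfolding nk by (simp add: nn_integral_density nn_integral_cmult[symmetric] mult_ac add.commute)
  also have "\<dots> \<le> (\<integral>\<^sup>+x. ennreal (r * normal_density 0 (sqrt \<tau>) (b + r * x)) * f (b + r * x) \<partial>lborel)"
    by (intro nn_integral_mono mult_right_mono ennreal_leI dens) simp
  also have "\<dots> = ennreal \<bar>r\<bar> *
      (\<integral>\<^sup>+x. ennreal (normal_density 0 (sqrt \<tau>) (b + r * x)) * f (b + r * x) \<partial>lborel)"
    using r by (simp add: nn_integral_cmult[symmetric] ennreal_mult' mult_ac)
  also have "\<dots> = (\<integral>\<^sup>+x. ennreal (normal_density 0 (sqrt \<tau>) x) * f x \<partial>lborel)"
    using r by (intro nn_integral_real_affine[symmetric]) auto
  also have "\<dots> = (\<integral>\<^sup>+x. f x \<partial>density lborel (normal_density 0 (sqrt \<tau>)))"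
    by (simp add: nn_integral_density)
  finally show ?thesis unfolding r_def .
qed

subsection \<open>Hitting by sums of independent coordinates\<close>

text \<open>The two forms are the two orders of integration: coordinate \<open>i\<close> innermost,
  then outermost. The factor \<open>k\<close> stays under the integral so that an inequality between
  sections can be integrated as it stands.\<close>

lemma (in product_sigma_finite) cmult_emeasure_PiM_insert:
  assumes "finite I" "i \<notin> I" and A [measurable]: "A \<in> sets (PiM (insert i I) M)"
  shows "k * emeasure (PiM (insert i I) M) A
      = (\<integral>\<^sup>+x. k * emeasure (M i) {y \<in> space (M i). x(i := y) \<in> A} \<partial>PiM I M)"
    and "k * emeasure (PiM (insert i I) M) A
      = (\<integral>\<^sup>+y. k * emeasure (PiM I M) {x \<in> space (PiM I M). x(i := y) \<in> A} \<partial>M i)"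
proof -
  have eq: "k * emeasure (PiM (insert i I) M) A = (\<integral>\<^sup>+x. k * indicator A x \<partial>PiM (insert i I) M)"
    by (simp add: nn_integral_cmult)
  have "(\<integral>\<^sup>+y. k * indicator A (x(i := y)) \<partial>M i)
      = k * emeasure (M i) {y \<in> space (M i). x(i := y) \<in> A}" if x: "x \<in> space (PiM I M)" for x
  proof -
    have "(\<lambda>y. x(i := y)) \<in> M i \<rightarrow>\<^sub>M PiM (insert i I) M"
      using x \<open>i \<notin> I\<close> by measurable
    then have [measurable]: "{y \<in> space (M i). x(i := y) \<in> A} \<in> sets (M i)" by measurable
    have "(\<integral>\<^sup>+y. k * indicator A (x(i := y)) \<partial>M i)
        = (\<integral>\<^sup>+y. k * indicator {y \<in> space (M i). x(i := y) \<in> A} y \<partial>M i)"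
      by (intro nn_integral_cong) (auto split: split_indicator)
    then show ?thesis by (simp add: nn_integral_cmult)
  qed
  then show "k * emeasure (PiM (insert i I) M) A
      = (\<integral>\<^sup>+x. k * emeasure (M i) {y \<in> space (M i). x(i := y) \<in> A} \<partial>PiM I M)"
    unfolding eq using assms by (subst product_nn_integral_insert) (auto intro!: nn_integral_cong)
  have "(\<integral>\<^sup>+x. k * indicator A (x(i := y)) \<partial>PiM I M)
      = k * emeasure (PiM I M) {x \<in> space (PiM I M). x(i := y) \<in> A}" if y: "y \<in> space (M i)" for y
  proof -
    have "(\<lambda>x. x(i := y)) \<in> PiM I M \<rightarrow>\<^sub>M PiM (insert i I) M"
      using y by measurable
    then have [measurable]: "{x \<in> space (PiM I M). x(i := y) \<in> A} \<in> sets (PiM I M)" by measurable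
    have "(\<integral>\<^sup>+x. k * indicator A (x(i := y)) \<partial>PiM I M)
        = (\<integral>\<^sup>+x. k * indicator {x \<in> space (PiM I M). x(i := y) \<in> A} x \<partial>PiM I M)"
      by (intro nn_integral_cong) (auto split: split_indicator)
    then show ?thesis by (simp add: nn_integral_cmult)
  qed
  then show "k * emeasure (PiM (insert i I) M) A
      = (\<integral>\<^sup>+y. k * emeasure (PiM I M) {x \<in> space (PiM I M). x(i := y) \<in> A} \<partial>M i)"
    unfolding eq using assms by (subst product_nn_integral_insert_rev) (auto intro!: nn_integral_cong)
qed

text \<open>Freezing coordinates turns the condition on the sum into membership in a finite union of
  translates of \<open>F\<close>, again a member of \<F>; hence the induction runs over all targets
  in \<F>. With coordinate \<open>i\<close> frozen, the induction hypothesis moves the other times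
  to their end points; with those frozen, \<open>one\<close> moves the time of
  \<open>i\<close>.\<close>

lemma PiM_hitting_le:
  fixes N :: "'k \<Rightarrow> 'b measure"
    and Y :: "'k \<Rightarrow> 't \<Rightarrow> 'b \<Rightarrow> 'v::{second_countable_topology, real_normed_vector}"
  assumes sf: "\<And>k. sigma_finite_measure (N k)"
    and \<F>: "\<And>F. F \<in> \<F> \<Longrightarrow> F \<in> sets borel"
      "\<And>F Q. F \<in> \<F> \<Longrightarrow> finite Q \<Longrightarrow> {x. \<exists>q\<in>Q. x + q \<in> F} \<in> \<F>"
    and "finite I"
    and G: "\<And>k. k \<in> I \<Longrightarrow> finite (G k)"
    and Y: "\<And>k t. k \<in> I \<Longrightarrow> t \<in> insert (\<tau> k) (G k) \<Longrightarrow> Y k t \<in> N k \<rightarrow>\<^sub>M borel"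
    and one: "\<And>k F. k \<in> I \<Longrightarrow> F \<in> \<F> \<Longrightarrow>
      \<kappa> k * emeasure (N k) {w \<in> space (N k). \<exists>t\<in>G k. Y k t w \<in> F}
        \<le> emeasure (N k) {w \<in> space (N k). Y k (\<tau> k) w \<in> F}"
    and "F \<in> \<F>"
  shows "(\<Prod>k\<in>I. \<kappa> k) * emeasure (PiM I N)
        {w \<in> space (PiM I N). \<exists>t\<in>PiE I G. (\<Sum>k\<in>I. Y k (t k) (w k)) \<in> F}
      \<le> emeasure (PiM I N) {w \<in> space (PiM I N). (\<Sum>k\<in>I. Y k (\<tau> k) (w k)) \<in> F}"
  using \<open>finite I\<close> G Y one \<open>F \<in> \<F>\<close>
proof (induction I arbitrary: F rule: finite_induct)
  case empty
  then show ?case by simp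
next
  case (insert i I)
  interpret product_sigma_finite N by (rule product_sigma_finite.intro) (rule sf)
  let ?J = "insert i I"
  have F: "{x \<in> space borel. x \<in> F} \<in> sets borel"
    using \<F>(1)[OF \<open>F \<in> \<F>\<close>] by simp
  have Yi: "Y i t \<in> N i \<rightarrow>\<^sub>M borel" if "t \<in> insert (\<tau> i) (G i)" for t
    using insert.prems(2) that by auto
  have YJ: "(\<lambda>w. Y k t (w k)) \<in> PiM ?J N \<rightarrow>\<^sub>M borel" if "k \<in> ?J" "t \<in> insert (\<tau> k) (G k)" for k t
    using measurable_compose[where g="Y k t", OF measurable_component_singleton[OF that(1), of N] insert.prems(2)[OF that]] .
  \<comment> \<open>All times are free in \<open>A\<close>, only that of \<open>i\<close> in
    \<open>C\<close>, none in \<open>D\<close>; the two halves of the step compare \<open>A\<close>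
    with \<open>C\<close> and \<open>C\<close> with \<open>D\<close>.\<close>
  define A where "A = {w \<in> space (PiM ?J N). \<exists>t\<in>PiE ?J G. (\<Sum>k\<in>?J. Y k (t k) (w k)) \<in> F}"
  define C where "C = {w \<in> space (PiM ?J N). \<exists>s\<in>G i. Y i s (w i) + (\<Sum>k\<in>I. Y k (\<tau> k) (w k)) \<in> F}"
  define D where "D = {w \<in> space (PiM ?J N). (\<Sum>k\<in>?J. Y k (\<tau> k) (w k)) \<in> F}"
  have fin: "finite (PiE ?J G)" using insert.hyps insert.prems(1) by (intro finite_PiE) auto
  have A: "A \<in> sets (PiM ?J N)"
    unfolding A_def by (intro sets.sets_Collect_finite_Ex fin measurable_sets_Collect[where P = "\<lambda>x. x \<in> F", OF _ F]
      borel_measurable_sum YJ pred_intros_finite) (auto simp: PiE_iff)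
  have C: "C \<in> sets (PiM ?J N)"
    unfolding C_def using insert.prems(1) by (intro sets.sets_Collect_finite_Ex measurable_sets_Collect[where P = "\<lambda>x. x \<in> F", OF _ F]
      borel_measurable_sum borel_measurable_add YJ) auto
  have D: "D \<in> sets (PiM ?J N)"
    unfolding D_def by (intro measurable_sets_Collect[where P = "\<lambda>x. x \<in> F", OF _ F] borel_measurable_sum YJ) auto
  have sumI: "(\<Sum>k\<in>?J. Y k (t k) ((x(i := y)) k)) = Y i (t i) y + (\<Sum>k\<in>I. Y k (t k) (x k))" for t x y
    using insert.hyps by (auto intro!: sum.cong)
  have sumI': "(\<Sum>k\<in>I. Y k (t k) ((x(i := y)) k)) = (\<Sum>k\<in>I. Y k (t k) (x k))" for t x y
    using insert.hyps by (auto intro!: sum.cong)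
  have sp: "x(i := y) \<in> space (PiM ?J N)" if "x \<in> space (PiM I N)" "y \<in> space (N i)" for x y
    using that by (auto simp: space_PiM PiE_iff extensional_def)
  have ExJ: "(\<exists>t\<in>PiE ?J G. P (t i) (\<Sum>k\<in>I. Y k (t k) (x k)))
      \<longleftrightarrow> (\<exists>s\<in>G i. \<exists>t\<in>PiE I G. P s (\<Sum>k\<in>I. Y k (t k) (x k)))" for P x
  proof -
    have "(\<Sum>k\<in>I. Y k ((t(i := s)) k) (x k)) = (\<Sum>k\<in>I. Y k (t k) (x k))" for t s
      using insert.hyps by (auto intro!: sum.cong)
    then show ?thesis by (auto simp: PiE_insert_eq)
  qed
  have "(\<Prod>k\<in>?J. \<kappa> k) * emeasure (PiM ?J N) A
      = \<kappa> i * ((\<Prod>k\<in>I. \<kappa> k) * emeasure (PiM ?J N) A)"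
    using insert.hyps by (simp add: mult_ac)
  also have "(\<Prod>k\<in>I. \<kappa> k) * emeasure (PiM ?J N) A
      \<le> 1 * emeasure (PiM ?J N) C"
    unfolding cmult_emeasure_PiM_insert(2)[OF insert.hyps A] cmult_emeasure_PiM_insert(2)[OF insert.hyps C]
  proof (rule nn_integral_mono)
    fix y assume y: "y \<in> space (N i)"
    \<comment> \<open>Coordinate \<open>i\<close> is fixed at \<open>y\<close> while its time still
      ranges over \<open>G i\<close>, so the other coordinates face one translate per grid time, all
      at once.\<close>
    define F' where "F' = {v. \<exists>q\<in>(\<lambda>s. Y i s y) ` G i. v + q \<in> F}"
    have "F' \<in> \<F>" unfolding F'_def using insert.prems by (intro \<F>(2)) auto
    then have "(\<Prod>k\<in>I. \<kappa> k) * emeasure (PiM I N)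
        {x \<in> space (PiM I N). \<exists>t\<in>PiE I G. (\<Sum>k\<in>I. Y k (t k) (x k)) \<in> F'}
      \<le> emeasure (PiM I N) {x \<in> space (PiM I N). (\<Sum>k\<in>I. Y k (\<tau> k) (x k)) \<in> F'}"
      using insert.prems by (intro insert.IH) auto
    also have "{x \<in> space (PiM I N). \<exists>t\<in>PiE I G. (\<Sum>k\<in>I. Y k (t k) (x k)) \<in> F'}
        = {x \<in> space (PiM I N). x(i := y) \<in> A}"
      using y by (auto simp: A_def sumI sp ExJ[of "\<lambda>s v. Y i s y + v \<in> F"] F'_def add.commute
        simp del: fun_upd_apply)
    also have "{x \<in> space (PiM I N). (\<Sum>k\<in>I. Y k (\<tau> k) (x k)) \<in> F'}
        = {x \<in> space (PiM I N). x(i := y) \<in> C}"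
      using y by (auto simp: C_def sumI' sp F'_def add.commute fun_upd_same simp del: fun_upd_apply)
    finally show "(\<Prod>k\<in>I. \<kappa> k) * emeasure (PiM I N) {x \<in> space (PiM I N). x(i := y) \<in> A}
      \<le> 1 * emeasure (PiM I N) {x \<in> space (PiM I N). x(i := y) \<in> C}" by (simp only: mult_1_left)
  qed
  also have "\<kappa> i * (1 * emeasure (PiM ?J N) C) = \<kappa> i * emeasure (PiM ?J N) C" by simp
  also have "\<dots> \<le> 1 * emeasure (PiM ?J N) D"
    unfolding cmult_emeasure_PiM_insert(1)[OF insert.hyps C] cmult_emeasure_PiM_insert(1)[OF insert.hyps D]
  proof (rule nn_integral_mono)
    fix x assume x: "x \<in> space (PiM I N)"
    \<comment> \<open>The other times are already at their end points, so the union has a single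
      member.\<close>
    define F' where "F' = {v. \<exists>q\<in>{\<Sum>k\<in>I. Y k (\<tau> k) (x k)}. v + q \<in> F}"
    have "F' \<in> \<F>" unfolding F'_def using insert.prems by (intro \<F>(2)) auto
    then have "\<kappa> i * emeasure (N i) {y \<in> space (N i). \<exists>t\<in>G i. Y i t y \<in> F'}
        \<le> emeasure (N i) {y \<in> space (N i). Y i (\<tau> i) y \<in> F'}"
      using insert.prems by auto
    also have "{y \<in> space (N i). \<exists>t\<in>G i. Y i t y \<in> F'} = {y \<in> space (N i). x(i := y) \<in> C}"
      using x by (auto simp: C_def sumI' sp F'_def fun_upd_same simp del: fun_upd_apply)
    also have "{y \<in> space (N i). Y i (\<tau> i) y \<in> F'} = {y \<in> space (N i). x(i := y) \<in> D}"
      using x by (auto simp: D_def sumI sp F'_def simp del: fun_upd_apply)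
    finally show "\<kappa> i * emeasure (N i) {y \<in> space (N i). x(i := y) \<in> C}
      \<le> 1 * emeasure (N i) {y \<in> space (N i). x(i := y) \<in> D}" by (simp only: mult_1_left)
  qed
  finally show ?case by (simp add: A_def D_def mult_left_mono)
qed

subsection \<open>Increments of Brownian motion\<close>

lemma borel_measurable_vec_lambda:
  fixes f :: "'b \<Rightarrow> 'n::finite \<Rightarrow> real"
  assumes "\<And>i. (\<lambda>x. f x i) \<in> borel_measurable N"
  shows "(\<lambda>x. \<chi> i. f x i) \<in> borel_measurable N"
  using assms by (subst borel_measurable_euclidean_space) (auto simp: Basis_vec_def inner_axis)

lemma borel_measurable_matrix_vector_mult [measurable (raw)]:
  fixes A :: "real ^ 'n ^ 'm"
  assumes "f \<in> borel_measurable N"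
  shows "(\<lambda>x. A *v f x) \<in> borel_measurable N"
  using assms by (rule borel_measurable_continuous_on[OF linear_continuous_on, rotated])
    (rule matrix_vector_mul_bounded_linear)

context brownian_motion
begin

lemma borel_measurable_component [measurable (raw)]:
  "0 \<le> t \<Longrightarrow> (\<lambda>\<omega>. B t \<omega> $ i) \<in> borel_measurable M"
  by (rule std_brownian_motion.rv[OF components])

lemma borel_measurable_motion [measurable (raw)]: "0 \<le> t \<Longrightarrow> B t \<in> borel_measurable M"
  using borel_measurable_vec_lambda[of "\<lambda>\<omega> i. B t \<omega> $ i" M] borel_measurable_component by simp

lemma AE_start: "AE \<omega> in M. B 0 \<omega> = 0"
  using std_brownian_motion.start[OF components] by (simp add: vec_eq_iff AE_all_countable)

text \<open>Independence is assumed for whole component paths, so it passes to one real functional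
  of each. The increments and the affine images of \<open>B T\<close> compared below are such
  functionals.\<close>

lemma distr_path_functionals:
  assumes g: "\<And>i. g i \<in> borel_measurable (path_space :: (real \<Rightarrow> real) measure)"
  defines "X \<equiv> \<lambda>i \<omega>. g i (path (\<lambda>t \<omega>. B t \<omega> $ i) \<omega>) :: real"
  shows "distr M (PiM UNIV (\<lambda>_. borel)) (\<lambda>\<omega> i. X i \<omega>) = PiM UNIV (\<lambda>i. distr M borel (X i))"
proof -
  have "indep_vars (\<lambda>_. borel) X UNIV"
    unfolding X_def using g by (intro indep_vars_compose2[OF indep_components])
  then show ?thesis
    using indep_vars_iff_distr_eq_PiM'[where I = UNIV and M' = "\<lambda>_. borel" and X = X]
    by (auto simp: indep_vars_def2 restrict_UNIV)
qed

lemma distributed_component: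
  assumes "0 < t"
  shows "distributed M lborel (\<lambda>\<omega>. B t \<omega> $ i) (normal_density 0 (sqrt t))"
proof -
  have d: "distributed M lborel (\<lambda>\<omega>. B t \<omega> $ i - B 0 \<omega> $ i) (normal_density 0 (sqrt t))"
    using std_brownian_motion.normal_increments[OF components, of 0 t i] assms by simp
  have "distr M lborel (\<lambda>\<omega>. B t \<omega> $ i) = distr M lborel (\<lambda>\<omega>. B t \<omega> $ i - B 0 \<omega> $ i)"
    using AE_start assms by (intro distr_cong_AE) auto
  then show ?thesis using d assms by (simp add: distributed_def)
qed

text \<open>The one-dimensional comparison is applied to each independent component, and the factors
  exp(-b_i^2 / (t - s)) / sqrt 2 multiply to the constant. The Gaussian of half the variance is
  written as a multiple of \<open>B T\<close> because the cone condition supplies probabilities for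
  the process at time \<open>T\<close>.\<close>

lemma gaussian_increment_ge:
  assumes "0 \<le> s" "s < t" "0 < T" and W [measurable]: "W \<in> sets (borel :: (real ^ 'd) measure)"
  shows "ennreal (exp (- (norm b)\<^sup>2 / (t - s)) / 2 powr (real CARD('d) / 2))
      * emeasure M {\<omega> \<in> space M. sqrt ((t - s) / (2 * T)) *\<^sub>R B T \<omega> + b \<in> W}
    \<le> emeasure M {\<omega> \<in> space M. B t \<omega> - B s \<omega> \<in> W}"
proof -
  define r where "r = sqrt ((t - s) / (2 * T))"
  define X where "X = (\<lambda>i \<omega>. B t \<omega> $ i - B s \<omega> $ i)"
  define X' where "X' = (\<lambda>i \<omega>. r * B T \<omega> $ i + b $ i)"
  define N where "N = (\<lambda>i. distr M borel (X i))"
  define N' where "N' = (\<lambda>i. distr M borel (X' i))"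
  have t: "0 \<le> t" using assms by simp
  have X [measurable]: "X i \<in> borel_measurable M" for i
    unfolding X_def using assms t by (intro borel_measurable_diff borel_measurable_component)
  have X' [measurable]: "X' i \<in> borel_measurable M" for i
    unfolding X'_def using assms
    by (intro borel_measurable_add borel_measurable_times borel_measurable_component) auto
  have comp: "(\<lambda>w. w u) \<in> borel_measurable (path_space :: (real \<Rightarrow> real) measure)" if "0 \<le> u" for u
    unfolding path_space_def using that by (intro measurable_component_singleton) auto
  have distX: "distr M (PiM UNIV (\<lambda>_. borel)) (\<lambda>\<omega> i. X i \<omega>) = PiM UNIV N"
    using distr_path_functionals[of "\<lambda>i w. w t - w s"] comp assms t
    by (simp add: path_def X_def N_def)
  have distX': "distr M (PiM UNIV (\<lambda>_. borel)) (\<lambda>\<omega> i. X' i \<omega>) = PiM UNIV N'"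
    using distr_path_functionals[of "\<lambda>i w. r * w T + b $ i"] comp assms
    by (simp add: path_def X'_def N'_def)
  have psN: "prob_space (N i)" and psN': "prob_space (N' i)" for i
    unfolding N_def N'_def by (auto intro!: prob_space_distr)
  have one: "ennreal (exp (- (b $ i)\<^sup>2 / (t - s)) / sqrt 2) * (\<integral>\<^sup>+x. g x \<partial>N' i) \<le> (\<integral>\<^sup>+x. g x \<partial>N i)"
    if "g \<in> borel_measurable (N i)" for i g
  proof -
    have g [measurable]: "g \<in> borel_measurable borel" using that by (simp add: N_def)
    have [measurable]: "(\<lambda>\<omega>. B T \<omega> $ i) \<in> borel_measurable M"
      using assms by (intro borel_measurable_component) auto
    have "(\<integral>\<^sup>+x. g x \<partial>N' i) = (\<integral>\<^sup>+\<omega>. g (r * B T \<omega> $ i + b $ i) \<partial>M)"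
      unfolding N'_def by (subst nn_integral_distr) (simp_all add: X'_def)
    also have "\<dots> = (\<integral>\<^sup>+x. g (r * x + b $ i) \<partial>distr M lborel (\<lambda>\<omega>. B T \<omega> $ i))"
      by (subst nn_integral_distr) simp_all
    also have "distr M lborel (\<lambda>\<omega>. B T \<omega> $ i) = density lborel (normal_density 0 (sqrt T))"
      using distributed_component[OF \<open>0 < T\<close>] by (rule distributed_distr_eq_density)
    finally have "(\<integral>\<^sup>+x. g x \<partial>N' i)
      = (\<integral>\<^sup>+x. g (r * x + b $ i) \<partial>density lborel (normal_density 0 (sqrt T)))" .
    moreover have "N i = distr M lborel (X i)"
      unfolding N_def by (rule distr_cong) simp_all
    moreover have "distr M lborel (X i) = density lborel (normal_density 0 (sqrt (t - s)))"
      unfolding X_def using std_brownian_motion.normal_increments[OF components assms(1,2)]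
      by (rule distributed_distr_eq_density)
    ultimately show ?thesis
      using normal_affine_nn_integral_le[of g "t - s" T "b $ i"] assms by (simp add: r_def)
  qed
  \<comment> \<open>The indicator of \<open>W\<close> is read on coordinate functions instead of
    vectors, since the product measures live on functions.\<close>
  define f :: "('d \<Rightarrow> real) \<Rightarrow> ennreal" where "f = (\<lambda>x. indicator W (\<chi> i. x i))"
  have vec: "(\<lambda>x. \<chi> i. x i) \<in> PiM UNIV (\<lambda>_. borel) \<rightarrow>\<^sub>M (borel :: (real ^ 'd) measure)"
    by (intro borel_measurable_vec_lambda measurable_component_singleton) auto
  have f: "f \<in> borel_measurable (PiM UNIV (\<lambda>_::'d. borel))"
    unfolding f_def using vec by measurable
  have sets: "sets (PiM UNIV N) = sets (PiM UNIV (\<lambda>_::'d. borel))"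
    by (rule sets_PiM_cong) (simp_all add: N_def)
  have int: "(\<integral>\<^sup>+x. f x \<partial>PiM UNIV K) = emeasure M {\<omega> \<in> space M. (\<chi> i. U i \<omega>) \<in> W}"
    if "distr M (PiM UNIV (\<lambda>_. borel)) (\<lambda>\<omega> i. U i \<omega>) = PiM UNIV K"
      and [measurable]: "\<And>i. U i \<in> borel_measurable M" for K U
  proof -
    have U: "(\<lambda>\<omega> i. U i \<omega>) \<in> M \<rightarrow>\<^sub>M PiM UNIV (\<lambda>_. borel)"
      by (rule measurable_PiM_single') auto
    have [measurable]: "{\<omega> \<in> space M. (\<chi> i. U i \<omega>) \<in> W} \<in> sets M"
      using measurable_compose[OF U vec] by measurable
    have "(\<integral>\<^sup>+x. f x \<partial>PiM UNIV K) = (\<integral>\<^sup>+\<omega>. f (\<lambda>i. U i \<omega>) \<partial>M)"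
      unfolding that(1)[symmetric] using U f by (simp add: nn_integral_distr)
    also have "\<dots> = (\<integral>\<^sup>+\<omega>. indicator {\<omega> \<in> space M. (\<chi> i. U i \<omega>) \<in> W} \<omega> \<partial>M)"
      by (intro nn_integral_cong) (auto simp: f_def split: split_indicator)
    finally show ?thesis by simp
  qed
  have "(\<Prod>i\<in>UNIV. ennreal (exp (- (b $ i)\<^sup>2 / (t - s)) / sqrt 2)) * (\<integral>\<^sup>+x. f x \<partial>PiM UNIV N')
      \<le> (\<integral>\<^sup>+x. f x \<partial>PiM UNIV N)"
  proof (rule nn_integral_PiM_mono)
    show "f \<in> borel_measurable (PiM UNIV N)"
      using f by (simp only: measurable_cong_sets[OF sets refl])
    show "sets (N' i) = sets (N i)" for i by (simp add: N_def N'_def)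
    show "ennreal (exp (- (b $ i)\<^sup>2 / (t - s)) / sqrt 2) * (\<integral>\<^sup>+x. g x \<partial>N' i) \<le> (\<integral>\<^sup>+x. g x \<partial>N i)"
      if "g \<in> borel_measurable (N i)" for i g by (rule one[OF that])
  qed (auto intro: prob_space_imp_sigma_finite psN psN')
  moreover have "(\<Prod>i\<in>UNIV. ennreal (exp (- (b $ i)\<^sup>2 / (t - s)) / sqrt 2))
      = ennreal (exp (- (norm b)\<^sup>2 / (t - s)) / 2 powr (real CARD('d) / 2))"
  proof -
    have "(norm b)\<^sup>2 = (\<Sum>i\<in>UNIV. (b $ i)\<^sup>2)"
      by (simp add: norm_vec_def L2_set_def sum_nonneg)
    then have "(\<Prod>i\<in>UNIV. exp (- (b $ i)\<^sup>2 / (t - s))) = exp (- (norm b)\<^sup>2 / (t - s))"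
      by (simp add: sum_divide_distrib sum_negf flip: exp_sum)
    moreover have "sqrt 2 ^ CARD('d) = 2 powr (real CARD('d) / 2)"
      by (simp add: powr_half_sqrt[symmetric] powr_powr flip: powr_realpow)
    ultimately show ?thesis by (simp add: prod_ennreal prod_dividef)
  qed
  moreover have "(\<chi> i. X i \<omega>) = B t \<omega> - B s \<omega>" "(\<chi> i. X' i \<omega>) = r *\<^sub>R B T \<omega> + b" for \<omega>
    by (simp_all add: X_def X'_def vec_eq_iff)
  ultimately show ?thesis
    using int[OF distX X] int[OF distX' X'] by (simp add: r_def)
qed

text \<open>Two factorisations are combined: independence of the component paths splits over
  \<open>i\<close>, and independence of the increments of one component splits over
  \<open>l\<close>.\<close>

lemma indep_grid_increments:
  assumes "0 < h"
  shows "indep_vars (\<lambda>_. borel)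
    (\<lambda>(l, i) \<omega>. B (real (Suc l) * h) \<omega> $ i - B (real l * h) \<omega> $ i) ({..<m} \<times> UNIV)"
proof (cases "m = 0")
  \<comment> \<open>Without increments the index set is empty, whereas the product rules of the
    other case ask for a nonempty one.\<close>
  case True
  then show ?thesis by (simp add: indep_vars_def2 indep_sets_def)
next
  case False
  define X where "X = (\<lambda>(l, i) \<omega>. B (real (Suc l) * h) \<omega> $ i - B (real l * h) \<omega> $ i)"
  have X [measurable]: "X p \<in> borel_measurable M" for p
    unfolding X_def using assms by (cases p) (auto intro!: borel_measurable_diff borel_measurable_component)
  have eq: "prob (\<Inter>p\<in>{..<m} \<times> UNIV. X p -` E p \<inter> space M)
      = (\<Prod>p\<in>{..<m} \<times> UNIV. prob (X p -` E p \<inter> space M))"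
    if E: "\<And>p. p \<in> {..<m} \<times> UNIV \<Longrightarrow> E p \<in> sets borel" for E
  proof -
    \<comment> \<open>All requirements on component \<open>i\<close> are gathered into one event of
      its path space, to which independence of the component paths applies directly.\<close>
    define C where "C = (\<lambda>i. {w \<in> space path_space.
      \<forall>l\<in>{..<m}. w (real (Suc l) * h) - w (real l * h) \<in> E (l, i)})"
    define \<pi> where "\<pi> = (\<lambda>i. path (\<lambda>t \<omega>. B t \<omega> $ i))"
    have C: "C i \<in> sets path_space" for i
    proof -
      have "(\<lambda>w. w (real (Suc l) * h) - w (real l * h)) \<in> borel_measurable (path_space :: (real \<Rightarrow> real) measure)" for l
        unfolding path_space_def using assms
        by (intro borel_measurable_diff measurable_component_singleton) auto
      then show ?thesis
        unfolding C_def using E by (intro sets.sets_Collect_finite_All) (auto intro: measurable_sets_Collect)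
    qed
    have \<pi>: "\<pi> i \<omega> \<in> space path_space" for i \<omega>
      by (auto simp: \<pi>_def path_def path_space_def space_PiM)
    have \<pi>C: "\<pi> i -` C i \<inter> space M = (\<Inter>l\<in>{..<m}. X (l, i) -` E (l, i) \<inter> space M)" for i
      using False \<pi> assms by (auto simp: C_def X_def \<pi>_def path_def)
    have "(\<Inter>p\<in>{..<m} \<times> UNIV. X p -` E p \<inter> space M)
        = (\<Inter>i\<in>UNIV. \<pi> i -` C i \<inter> space M)"
      unfolding \<pi>C by auto
    also have "prob \<dots> = (\<Prod>i\<in>UNIV. prob (\<pi> i -` C i \<inter> space M))"
      using indep_components C unfolding \<pi>_def by (intro indep_varsD_finite) auto
    also have "\<dots> = (\<Prod>i\<in>UNIV. \<Prod>l<m. prob (X (l, i) -` E (l, i) \<inter> space M))"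
    proof (rule prod.cong[OF refl])
      fix i
      have "indep_vars (\<lambda>_. borel) (\<lambda>l. X (l, i)) {..<m}"
        using std_brownian_motion.indep_increments[OF components[of i], of "\<lambda>l. real l * h" m] assms
        by (simp add: X_def strict_mono_def)
      then show "prob (\<pi> i -` C i \<inter> space M) = (\<Prod>l<m. prob (X (l, i) -` E (l, i) \<inter> space M))"
        unfolding \<pi>C using False E by (intro indep_varsD_finite) auto
    qed
    also have "\<dots> = (\<Prod>p\<in>{..<m} \<times> UNIV. prob (X p -` E p \<inter> space M))"
      by (subst prod.swap) (simp add: prod.cartesian_product)
    finally show ?thesis .
  qed
  have "indep_vars (\<lambda>_. borel) X ({..<m} \<times> UNIV)"
  proof (subst indep_vars_finite[where E = "\<lambda>_. sets borel"])
    show "\<forall>E\<in>{..<m} \<times> UNIV \<rightarrow> sets borel. prob (\<Inter>p\<in>{..<m} \<times> UNIV. X p -` E p \<inter> space M)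
      = (\<Prod>p\<in>{..<m} \<times> UNIV. prob (X p -` E p \<inter> space M))"
      by (intro ballI eq) (auto simp: Pi_iff)
    show "sets borel = sigma_sets (space borel) (sets (borel :: real measure))"
      by (rule sets.sigma_sets_eq[symmetric])
    show "sets borel \<subseteq> Pow (space (borel :: real measure))" by (rule sets.space_closed)
  qed (use False in \<open>auto simp: Int_stable_def\<close>)
  then show ?thesis unfolding X_def .
qed

end

subsection \<open>Hitting of a single process along a grid\<close>

context brownian_motion
begin

text \<open>Both variables are sums of elementary increments, over the disjoint blocks below
  \<open>j\<close> and from \<open>j\<close> to \<open>m - 1\<close>. Positions are taken relative
  to \<open>B 0\<close> because only differences telescope. The future increment is a function on
  \<open>{m}\<close> because \<open>indep_var\<close> relates two variables with values in one
  type.\<close>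

lemma indep_grid_path_increment:
  assumes "0 < h" "j \<le> m"
  shows "indep_var (PiM {..j} (\<lambda>_. borel)) (\<lambda>\<omega>. \<lambda>l\<in>{..j}. B (real l * h) \<omega> - B 0 \<omega>)
    (PiM {m} (\<lambda>_. borel)) (\<lambda>\<omega>. \<lambda>l\<in>{m}. B (real l * h) \<omega> - B (real j * h) \<omega>)"
proof -
  define X where "X = (\<lambda>(l, i) \<omega>. B (real (Suc l) * h) \<omega> $ i - B (real l * h) \<omega> $ i)"
  define Y\<^sub>1 where "Y\<^sub>1 = (\<lambda>x :: nat \<times> 'd \<Rightarrow> real. \<lambda>l\<in>{..j}. \<chi> i. \<Sum>l' = 0..<l. x (l', i))"
  define Y\<^sub>2 where "Y\<^sub>2 = (\<lambda>x :: nat \<times> 'd \<Rightarrow> real. \<lambda>k\<in>{m}. \<chi> i. \<Sum>l = j..<k. x (l, i))"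
  have "indep_var (PiM ({..<j} \<times> UNIV) (\<lambda>_. borel)) (\<lambda>\<omega>. \<lambda>p\<in>{..<j} \<times> UNIV. X p \<omega>)
      (PiM ({j..<m} \<times> UNIV) (\<lambda>_. borel)) (\<lambda>\<omega>. \<lambda>p\<in>{j..<m} \<times> UNIV. X p \<omega>)"
    using indep_grid_increments[OF \<open>0 < h\<close>, of m] \<open>j \<le> m\<close> unfolding X_def
    by (intro indep_var_restrict) auto
  moreover have "Y\<^sub>1 \<in> PiM ({..<j} \<times> UNIV) (\<lambda>_. borel) \<rightarrow>\<^sub>M PiM {..j} (\<lambda>_. borel)"
    unfolding Y\<^sub>1_def by (intro measurable_restrict borel_measurable_vec_lambda borel_measurable_sum
      measurable_component_singleton) auto
  moreover have "Y\<^sub>2 \<in> PiM ({j..<m} \<times> UNIV) (\<lambda>_. borel) \<rightarrow>\<^sub>M PiM {m} (\<lambda>_. borel)"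
    unfolding Y\<^sub>2_def by (intro measurable_restrict borel_measurable_vec_lambda borel_measurable_sum
      measurable_component_singleton) auto
  ultimately have "indep_var (PiM {..j} (\<lambda>_. borel)) (Y\<^sub>1 \<circ> (\<lambda>\<omega>. \<lambda>p\<in>{..<j} \<times> UNIV. X p \<omega>))
      (PiM {m} (\<lambda>_. borel)) (Y\<^sub>2 \<circ> (\<lambda>\<omega>. \<lambda>p\<in>{j..<m} \<times> UNIV. X p \<omega>))"
    by (rule indep_var_compose)
  moreover have "Y\<^sub>1 \<circ> (\<lambda>\<omega>. \<lambda>p\<in>{..<j} \<times> UNIV. X p \<omega>)
      = (\<lambda>\<omega>. \<lambda>l\<in>{..j}. B (real l * h) \<omega> - B 0 \<omega>)"
  proof (intro ext)
    fix \<omega> l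
    have "(\<Sum>l' = 0..<l. X (l', i) \<omega>) = B (real l * h) \<omega> $ i - B 0 \<omega> $ i" for i
      using sum_Suc_diff'[of 0 l "\<lambda>l. B (real l * h) \<omega> $ i"] by (simp add: X_def)
    then show "(Y\<^sub>1 \<circ> (\<lambda>\<omega>. \<lambda>p\<in>{..<j} \<times> UNIV. X p \<omega>)) \<omega> l
        = (\<lambda>l\<in>{..j}. B (real l * h) \<omega> - B 0 \<omega>) l"
      by (simp add: Y\<^sub>1_def vec_eq_iff)
  qed
  moreover have "Y\<^sub>2 \<circ> (\<lambda>\<omega>. \<lambda>p\<in>{j..<m} \<times> UNIV. X p \<omega>)
      = (\<lambda>\<omega>. \<lambda>l\<in>{m}. B (real l * h) \<omega> - B (real j * h) \<omega>)"
  proof (intro ext)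
    fix \<omega> l
    have "(\<Sum>l = j..<m. X (l, i) \<omega>) = B (real m * h) \<omega> $ i - B (real j * h) \<omega> $ i" for i
      using sum_Suc_diff'[of j m "\<lambda>l. B (real l * h) \<omega> $ i"] \<open>j \<le> m\<close> by (simp add: X_def)
    then show "(Y\<^sub>2 \<circ> (\<lambda>\<omega>. \<lambda>p\<in>{j..<m} \<times> UNIV. X p \<omega>)) \<omega> l
        = (\<lambda>l\<in>{m}. B (real l * h) \<omega> - B (real j * h) \<omega>) l"
      by (simp add: Y\<^sub>2_def vec_eq_iff)
  qed
  ultimately show ?thesis by simp
qed

text \<open>
  The bound \<open>r \<ge> sqrt 2\<close> covers the scalings \<open>r = sqrt (2 * T / (T - t))\<close> that turn the Gaussian
  of half the variance of \<open>B T - B t\<close> into the law of \<open>B T\<close>.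
\<close>

definition cone_stable :: "real ^ 'd ^ 'd \<Rightarrow> real \<Rightarrow> real \<Rightarrow> (real ^ 'd) set \<Rightarrow> bool" where
  "cone_stable A T e F \<longleftrightarrow> F \<in> sets borel \<and>
    (\<forall>x\<in>F. \<exists>W\<in>sets borel. (\<forall>w\<in>W. x + w \<in> F) \<and>
      (\<forall>r\<ge>sqrt 2. e \<le> measure M {\<omega> \<in> space M. (A *v B T \<omega>) /\<^sub>R r \<in> W}))"

text \<open>Once B T / r + b is substituted for the Brownian increment, the shift \<open>b\<close>
  cancels the drift over [t, T] and only A B T / r is left, which lies in the set \<open>W\<close>
  attached to \<open>x\<close> with probability at least \<open>e\<close>.\<close>

lemma cone_stable_increment_ge:
  assumes F: "cone_stable A T e F" and "x \<in> F"
    and A': "A ** A' = mat 1" and t: "0 \<le> t" "t < T"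
    and D: "D \<le> exp (- (norm (A' *v (c T - c t)))\<^sup>2 / (T - t))" "0 \<le> D"
  shows "ennreal (D * e / 2 powr (real CARD('d) / 2))
    \<le> emeasure M {\<omega> \<in> space M. x + (A *v (B T \<omega> - B t \<omega>) - (c T - c t)) \<in> F}"
proof -
  define b where "b = A' *v (c T - c t)"
  define r where "r = sqrt (2 * T / (T - t))"
  \<comment> \<open>Since 0 \<le> t < T, the quotient T / (T - t) is at least 1, which puts
    \<open>r\<close> in the range covered by \<open>cone_stable\<close>.\<close>
  have r: "r \<ge> sqrt 2" "r > 0" using t by (auto simp: r_def field_simps)
  have r': "sqrt ((T - t) / (2 * T)) = inverse r"
    using t by (simp add: r_def real_sqrt_divide)
  have Ab: "A *v b = c T - c t"
    by (simp add: b_def matrix_vector_mul_assoc A')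
  have F_borel: "F \<in> sets borel" using F by (simp add: cone_stable_def)
  obtain W where W [measurable]: "W \<in> sets borel" and WF: "\<And>w. w \<in> W \<Longrightarrow> x + w \<in> F"
    and We: "e \<le> measure M {\<omega> \<in> space M. (A *v B T \<omega>) /\<^sub>R r \<in> W}"
    using F \<open>x \<in> F\<close> r unfolding cone_stable_def by blast
  define W' where "W' = {v. A *v v - (c T - c t) \<in> W}"
  have [measurable]: "B T \<in> borel_measurable M" "B t \<in> borel_measurable M"
    using t by (auto intro: borel_measurable_motion)
  have "W' \<in> sets borel"
  proof -
    have "(\<lambda>v. A *v v - (c T - c t)) \<in> borel_measurable borel" by measurable
    then show ?thesis using measurable_sets[of _ borel borel W] by (auto simp: W'_def vimage_def)
  qed
  have "ennreal (D * e / 2 powr (real CARD('d) / 2))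
      = ennreal (D / 2 powr (real CARD('d) / 2)) * ennreal e"
    using D by (subst ennreal_mult'[symmetric]) auto
  also have "\<dots> \<le> ennreal (exp (- (norm b)\<^sup>2 / (T - t)) / 2 powr (real CARD('d) / 2))
      * emeasure M {\<omega> \<in> space M. (A *v B T \<omega>) /\<^sub>R r \<in> W}"
    using D We by (intro mult_mono ennreal_leI divide_right_mono) (auto simp: b_def emeasure_eq_measure)
  also have "{\<omega> \<in> space M. (A *v B T \<omega>) /\<^sub>R r \<in> W}
      = {\<omega> \<in> space M. sqrt ((T - t) / (2 * T)) *\<^sub>R B T \<omega> + b \<in> W'}"
    by (simp add: W'_def r' matrix_vector_right_distrib Ab matrix_vector_mult_scaleR)
  also have "ennreal (exp (- (norm b)\<^sup>2 / (T - t)) / 2 powr (real CARD('d) / 2)) * emeasure M \<dots>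
      \<le> emeasure M {\<omega> \<in> space M. B T \<omega> - B t \<omega> \<in> W'}"
    using t \<open>W' \<in> sets borel\<close> by (intro gaussian_increment_ge) auto
  also have "\<dots> \<le> emeasure M {\<omega> \<in> space M. x + (A *v (B T \<omega> - B t \<omega>) - (c T - c t)) \<in> F}"
  proof (rule emeasure_mono)
    show "{\<omega> \<in> space M. x + (A *v (B T \<omega> - B t \<omega>) - (c T - c t)) \<in> F} \<in> sets M"
      using F_borel by measurable
  qed (auto simp: W'_def WF)
  finally show ?thesis .
qed

text \<open>The constant does not depend on \<open>m\<close>: each first-hitting event is charged to
  its own intersection with the final event, and these intersections are disjoint, so summation
  costs nothing.\<close>

lemma hitting_grid_le:
  fixes m :: nat
  assumes F: "cone_stable A T e F" and A': "A ** A' = mat 1"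
    and D: "\<And>t. 0 \<le> t \<Longrightarrow> t < T \<Longrightarrow> D \<le> exp (- (norm (A' *v (c T - c t)))\<^sup>2 / (T - t))"
    and "0 \<le> D" "0 < T" "0 < m"
  shows "ennreal (D * e / 2 powr (real CARD('d) / 2))
      * emeasure M {\<omega> \<in> space M. \<exists>j\<le>m. A *v B (real j * (T / real m)) \<omega> - c (real j * (T / real m)) \<in> F}
    \<le> emeasure M {\<omega> \<in> space M. A *v B T \<omega> - c T \<in> F}"
proof (cases "F = {}")
  case False
  \<comment> \<open>Only a point of \<open>F\<close> yields a set whose probability bounds
    \<open>e\<close> from above, hence the separate case of an empty \<open>F\<close>.\<close>
  then have "e \<le> 1"
    using F unfolding cone_stable_def by (meson all_not_in_conv order_refl order_trans prob_le_1)
  moreover have "D \<le> 1"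
    using D[of 0] \<open>0 < T\<close> by (auto intro: order_trans)
  ultimately have De: "D * e \<le> 1"
    using \<open>0 \<le> D\<close> mult_left_mono[of e 1 D] by simp
  define h where "h = T / real m"
  have h: "h > 0" "real m * h = T" using assms by (auto simp: h_def)
  define \<kappa> where "\<kappa> = ennreal (D * e / 2 powr (real CARD('d) / 2))"
  \<comment> \<open>A constant of at most 1 settles a first hit at the last index \<open>m\<close>,
    where no increment remains to which the cone could be applied.\<close>
  have "D * e / 2 powr (real CARD('d) / 2) \<le> 1"
    using De ge_one_powr_ge_zero[of 2 "real CARD('d) / 2"] by (simp add: divide_le_eq)
  then have \<kappa>: "\<kappa> \<le> 1" by (simp add: \<kappa>_def)
  \<comment> \<open>Subtracting \<open>B 0\<close> fits the independence of past and future; almost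
    surely it changes nothing.\<close>
  define P where "P = (\<lambda>j \<omega>. B (real j * h) \<omega> - B 0 \<omega>)"
  define H where "H = (\<lambda>j. {\<omega> \<in> space M. A *v P j \<omega> - c (real j * h) \<in> F \<and>
    (\<forall>l<j. A *v P l \<omega> - c (real l * h) \<notin> F)})"
  define fin where "fin = {\<omega> \<in> space M. A *v P m \<omega> - c T \<in> F}"
  have F_borel [measurable]: "F \<in> sets borel" using F by (simp add: cone_stable_def)
  have B [measurable]: "B (real j * h) \<in> borel_measurable M" "B 0 \<in> borel_measurable M"
      "B T \<in> borel_measurable M" for j
    using h \<open>0 < T\<close> by (auto intro!: borel_measurable_motion)
  have P [measurable]: "P j \<in> borel_measurable M" for j unfolding P_def by measurable
  have H_sets [measurable]: "H j \<in> sets M" for j unfolding H_def by measurable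
  have fin_sets [measurable]: "fin \<in> sets M" unfolding fin_def by measurable
  have step: "\<kappa> * emeasure M (H j) \<le> emeasure M (H j \<inter> fin)" if "j \<le> m" for j
  proof (cases "j = m")
    case True
    then have "H j \<inter> fin = H j" using h by (auto simp: H_def fin_def)
    then show ?thesis using mult_right_mono[OF \<kappa>, of "emeasure M (H j)"] by simp
  next
    case False
    define t where "t = real j * h"
    have t: "0 \<le> t" "t < T"
      using False that h by (auto simp: t_def simp flip: h(2))
    let ?N = "PiM {..j} (\<lambda>_. borel :: (real ^ 'd) measure)"
    \<comment> \<open>\<open>?E\<close> is the first hit at \<open>j\<close> as a property of the
      past; \<open>?Q\<close> says that the past plus the remaining increment ends in
      \<open>F\<close>.\<close>
    let ?E = "{p \<in> space ?N. A *v p j - c t \<in> F \<and> (\<forall>l<j. A *v p l - c (real l * h) \<notin> F)}"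
    let ?Q = "\<lambda>p g. A *v (p j + g m) - c T \<in> F"
    let ?N' = "PiM {m} (\<lambda>_. borel :: (real ^ 'd) measure)"
    let ?G = "\<lambda>\<omega>. \<lambda>l\<in>{m}. B (real l * h) \<omega> - B t \<omega>"
    let ?X = "\<lambda>\<omega>. \<lambda>l\<in>{..j}. P l \<omega>"
    have p: "(\<lambda>p. p l) \<in> borel_measurable ?N" if "l \<le> j" for l
      using that by (intro measurable_component_singleton) auto
    have p1: "(\<lambda>p. A *v p l - v) \<in> borel_measurable ?N" if "l \<le> j" for l v
      using p[OF that] by measurable
    have "?E \<in> sets ?N"
    proof (intro sets.sets_Collect_conj)
      show "{p \<in> space ?N. A *v p j - c t \<in> F} \<in> sets ?N" using p1[of j] by measurable
      have "{p \<in> space ?N. A *v p l - c (real l * h) \<notin> F} \<in> sets ?N" if "l \<in> {..<j}" for l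
      proof -
        have "l \<le> j" using that by simp
        from p1[OF this] show ?thesis by measurable
      qed
      then have "{p \<in> space ?N. \<forall>l\<in>{..<j}. A *v p l - c (real l * h) \<notin> F} \<in> sets ?N"
        by (intro sets.sets_Collect_finite_All) auto
      then show "{p \<in> space ?N. \<forall>l<j. A *v p l - c (real l * h) \<notin> F} \<in> sets ?N" by simp
    qed
    moreover have "{x \<in> space (?N \<Otimes>\<^sub>M ?N'). ?Q (fst x) (snd x)} \<in> sets (?N \<Otimes>\<^sub>M ?N')"
    proof -
      have "(\<lambda>x. fst x j) \<in> borel_measurable (?N \<Otimes>\<^sub>M ?N')"
        using measurable_compose[OF measurable_fst p[of j]] by simp
      moreover have "(\<lambda>x. snd x m) \<in> borel_measurable (?N \<Otimes>\<^sub>M ?N')"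
        by (rule measurable_compose[OF measurable_snd measurable_component_singleton]) simp
      ultimately show ?thesis by measurable
    qed
    moreover have "\<kappa> \<le> emeasure M {\<omega> \<in> space M. ?Q p (?G \<omega>)}" if "p \<in> ?E" for p
    proof -
      \<comment> \<open>The end position is split into the point of \<open>F\<close> reached at time
        \<open>t\<close> and the drifted increment over [t, T].\<close>
      have "A *v (p j + g) - c T = A *v p j - c t + (A *v g - (c T - c t))" for g
        by (simp add: matrix_vector_right_distrib)
      then show ?thesis
        using cone_stable_increment_ge[OF F _ A' t, of "A *v p j - c t" D c] that D[OF t] \<open>0 \<le> D\<close>
        by (simp add: \<kappa>_def h(2) add_diff_eq matrix_vector_mult_diff_distrib)
    qed
    moreover have "indep_var ?N ?X ?N' ?G"
      using indep_grid_path_increment[OF h(1) \<open>j \<le> m\<close>] unfolding P_def t_def .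
    ultimately have "\<kappa> * emeasure M {\<omega> \<in> space M. ?X \<omega> \<in> ?E}
        \<le> emeasure M {\<omega> \<in> space M. ?X \<omega> \<in> ?E \<and> ?Q (?X \<omega>) (?G \<omega>)}"
      by (intro indep_var_emeasure_ge)
    moreover have "{\<omega> \<in> space M. ?X \<omega> \<in> ?E} = H j"
      by (auto simp: H_def t_def space_PiM)
    moreover have "P j \<omega> + (B T \<omega> - B t \<omega>) = P m \<omega>" for \<omega>
      by (simp add: P_def t_def h(2))
    then have "{\<omega> \<in> space M. ?X \<omega> \<in> ?E \<and> ?Q (?X \<omega>) (?G \<omega>)} = H j \<inter> fin"
      by (auto simp: H_def fin_def t_def space_PiM h(2))
    ultimately show ?thesis by simp
  qed
  have disj: "disjoint_family_on H {..m}"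
    unfolding disjoint_family_on_def by (auto simp: H_def) (metis linorder_neqE_nat)
  have hit: "{\<omega> \<in> space M. \<exists>j\<le>m. A *v P j \<omega> - c (real j * h) \<in> F} = (\<Union>j\<in>{..m}. H j)"
  proof (intro equalityI subsetI)
    fix \<omega> assume "\<omega> \<in> {\<omega> \<in> space M. \<exists>j\<le>m. A *v P j \<omega> - c (real j * h) \<in> F}"
    then obtain j where j: "\<omega> \<in> space M" "j \<le> m" "A *v P j \<omega> - c (real j * h) \<in> F" by auto
    define j\<^sub>0 where "j\<^sub>0 = (LEAST j. A *v P j \<omega> - c (real j * h) \<in> F)"
    have "A *v P j\<^sub>0 \<omega> - c (real j\<^sub>0 * h) \<in> F" "j\<^sub>0 \<le> j"
      using j unfolding j\<^sub>0_def by (auto intro: LeastI Least_le)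
    moreover have "A *v P l \<omega> - c (real l * h) \<notin> F" if "l < j\<^sub>0" for l
      using that not_less_Least unfolding j\<^sub>0_def by blast
    ultimately show "\<omega> \<in> (\<Union>j\<in>{..m}. H j)" using j by (auto simp: H_def intro!: bexI[of _ j\<^sub>0])
  qed (auto simp: H_def)
  have "{\<omega> \<in> space M. \<exists>j\<le>m. A *v B (real j * h) \<omega> - c (real j * h) \<in> F} \<in> sets M"
  proof -
    have "{\<omega> \<in> space M. A *v B (real j * h) \<omega> - c (real j * h) \<in> F} \<in> sets M" for j by measurable
    then have "{\<omega> \<in> space M. \<exists>j\<in>{..m}. A *v B (real j * h) \<omega> - c (real j * h) \<in> F} \<in> sets M"
      by (intro sets.sets_Collect_finite_Ex) auto
    then show ?thesis by (simp add: Bex_def)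
  qed
  then have "emeasure M {\<omega> \<in> space M. \<exists>j\<le>m. A *v B (real j * h) \<omega> - c (real j * h) \<in> F}
      = emeasure M (\<Union>j\<in>{..m}. H j)"
    using AE_start by (intro emeasure_eq_AE) (auto simp: P_def simp flip: hit)
  also have "\<dots> = (\<Sum>j\<le>m. emeasure M (H j))"
    using disj by (intro sum_emeasure[symmetric]) auto
  also have "\<kappa> * \<dots> = (\<Sum>j\<le>m. \<kappa> * emeasure M (H j))" by (rule sum_distrib_left)
  also have "\<dots> \<le> (\<Sum>j\<le>m. emeasure M (H j \<inter> fin))" by (intro sum_mono step) simp
  also have "\<dots> = emeasure M (\<Union>j\<in>{..m}. H j \<inter> fin)"
    using disj by (intro sum_emeasure) (auto simp: disjoint_family_on_def)
  also have "\<dots> \<le> emeasure M fin" by (intro emeasure_mono) auto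
  also have "\<dots> = emeasure M {\<omega> \<in> space M. A *v B T \<omega> - c T \<in> F}"
    using AE_start by (intro emeasure_eq_AE) (auto simp: fin_def P_def h(2))
  finally show ?thesis by (simp add: \<kappa>_def h_def)
qed simp

section \<open>Covariance matrix of the process and its inverse quadratic form\<close>

lemma covariance_matrix_linear_image:
  assumes "0 < T"
  shows "covariance_matrix M (\<lambda>\<omega>. A *v B T \<omega>) = T *\<^sub>R (A ** transpose A)"
proof -
  have d: "distributed M lborel (\<lambda>\<omega>. B T \<omega> $ i) (normal_density 0 (sqrt T))" for i
    by (rule distributed_component[OF assms])
  have int: "integrable M (\<lambda>\<omega>. B T \<omega> $ i)" for i
    using distributed_integrable_var[OF d] integrable_normal_moment_nz_1[of "sqrt T" 0] assms by simp
  have E0: "expectation (\<lambda>\<omega>. B T \<omega> $ i) = 0" for i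
    using normal_distributed_expectation[OF _ d] assms by simp
  have var: "expectation (\<lambda>\<omega>. B T \<omega> $ i * B T \<omega> $ i) = T" for i
    using normal_distributed_variance[OF _ d, of i] assms by (simp add: E0 power2_eq_square)
  have int2: "integrable M (\<lambda>\<omega>. B T \<omega> $ i * B T \<omega> $ i)" for i
    using distributed_integrable[OF d, of "\<lambda>x. x * x" i] integrable_normal_moment[of "sqrt T" 0 2] assms
    by (simp add: power2_eq_square)
  have ind: "indep_var borel (\<lambda>\<omega>. B T \<omega> $ i) borel (\<lambda>\<omega>. B T \<omega> $ k)" if "i \<noteq> k" for i k
  proof -
    have "(\<lambda>w. w T) \<in> borel_measurable (path_space :: (real \<Rightarrow> real) measure)"
      unfolding path_space_def using assms by (intro measurable_component_singleton) auto
    then have "indep_vars (\<lambda>_. borel) (\<lambda>i \<omega>. path (\<lambda>t \<omega>. B t \<omega> $ i) \<omega> T) UNIV"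
      by (intro indep_vars_compose2[OF indep_components])
    then have "indep_vars (\<lambda>_. borel) (\<lambda>i \<omega>. B T \<omega> $ i) UNIV"
      using assms by (simp add: path_def)
    then have "indep_var (PiM {i} (\<lambda>_. borel)) (\<lambda>\<omega>. \<lambda>l\<in>{i}. B T \<omega> $ l)
        (PiM {k} (\<lambda>_. borel)) (\<lambda>\<omega>. \<lambda>l\<in>{k}. B T \<omega> $ l)"
      using that by (intro indep_var_restrict) auto
    then have "indep_var borel ((\<lambda>x. x i) \<circ> (\<lambda>\<omega>. \<lambda>l\<in>{i}. B T \<omega> $ l))
        borel ((\<lambda>x. x k) \<circ> (\<lambda>\<omega>. \<lambda>l\<in>{k}. B T \<omega> $ l))"
      by (rule indep_var_compose) (auto intro!: measurable_component_singleton)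
    then show ?thesis by (simp add: comp_def)
  qed
  \<comment> \<open>Off the diagonal, independence and zero means give 0, so \<open>B T\<close> has
    covariance T times the identity; conjugation by \<open>A\<close> then gives the claim.\<close>
  have prod: "integrable M (\<lambda>\<omega>. B T \<omega> $ i * B T \<omega> $ k)"
    "expectation (\<lambda>\<omega>. B T \<omega> $ i * B T \<omega> $ k) = (if i = k then T else 0)" for i k
    using indep_var_integrable[OF ind int int] indep_var_lebesgue_integral[OF ind int int] int2 var E0
    by (cases "i = k"; simp)+
  have "expectation (\<lambda>\<omega>. (A *v B T \<omega>) $ i) = 0" for i
    using int E0 by (simp add: matrix_vector_mult_def)
  moreover have "expectation (\<lambda>\<omega>. (A *v B T \<omega>) $ i * (A *v B T \<omega>) $ j) = T * (A ** transpose A) $ i $ j" for i j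
  proof -
    have "(\<lambda>\<omega>. (A *v B T \<omega>) $ i * (A *v B T \<omega>) $ j)
      = (\<lambda>\<omega>. \<Sum>k\<in>UNIV. \<Sum>l\<in>UNIV. (A $ i $ k * A $ j $ l) * (B T \<omega> $ k * B T \<omega> $ l))"
      by (simp add: matrix_vector_mult_def sum_product mult_ac)
    then have "expectation (\<lambda>\<omega>. (A *v B T \<omega>) $ i * (A *v B T \<omega>) $ j)
      = (\<Sum>k\<in>UNIV. \<Sum>l\<in>UNIV. (A $ i $ k * A $ j $ l) * (if k = l then T else 0))"
      by (simp add: prod)
    also have "\<dots> = (\<Sum>k\<in>UNIV. (A $ i $ k * A $ j $ k) * T)"
      by (intro sum.cong) (simp_all add: if_distrib[of "(*) _"] cong: if_cong)
    finally show ?thesis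
      by (simp add: matrix_matrix_mult_def transpose_def sum_distrib_left mult_ac)
  qed
  ultimately show ?thesis by (simp add: covariance_matrix_def vec_eq_iff)
qed

end

lemma matrix_inv_right:
  fixes A :: "real ^ 'n ^ 'n"
  assumes "invertible A"
  shows "A ** matrix_inv A = mat 1"
  using someI_ex[OF assms[unfolded invertible_def]] by (simp add: matrix_inv_def)

text \<open>No formula for the inverse is needed. With z the solution of T A A^T z = q and A y = q,
  injectivity of \<open>A\<close> gives T A^T z = y, and so |y|^2 = T (y . A^T z) = T (A y . z) = T
  (q . z).\<close>

lemma scaled_gram_inverse_quadratic_form:
  fixes A :: "real ^ 'n ^ 'n"
  assumes "invertible A" "0 < T"
  shows "T * (q \<bullet> (matrix_inv (T *\<^sub>R (A ** transpose A)) *v q)) = (norm (matrix_inv A *v q))\<^sup>2"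
proof -
  define y where "y = matrix_inv A *v q"
  define z where "z = matrix_inv (T *\<^sub>R (A ** transpose A)) *v q"
  have y: "A *v y = q"
    by (simp add: y_def matrix_vector_mul_assoc matrix_inv_right \<open>invertible A\<close>)
  have "invertible (A ** transpose A)"
    using \<open>invertible A\<close> by (simp add: invertible_mult transpose_invertible)
  then have "invertible (T *\<^sub>R (A ** transpose A))"
    using \<open>0 < T\<close> by (intro scalar_invertible) auto
  then have "(T *\<^sub>R (A ** transpose A)) *v z = q"
    by (simp add: z_def matrix_vector_mul_assoc matrix_inv_right)
  then have "A *v (T *\<^sub>R (transpose A *v z)) = A *v y"
    by (metis y matrix_vector_mult_scaleR scaleR_matrix_vector_assoc matrix_vector_mul_assoc)
  then have "T *\<^sub>R (transpose A *v z) = y"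
    using inj_matrix_vector_mult[OF \<open>invertible A\<close>] by (simp add: inj_eq)
  then have "(norm y)\<^sup>2 = T * (y \<bullet> (transpose A *v z))"
    by (metis inner_scaleR_right power2_norm_eq_inner)
  also have "y \<bullet> (transpose A *v z) = (z v* A) \<bullet> y"
    by (simp add: inner_commute)
  also have "\<dots> = q \<bullet> z"
    by (metis dot_lmul_matrix y inner_commute)
  finally show ?thesis by (simp add: y_def z_def)
qed

subsection \<open>Refinement of the grid\<close>

text \<open>The attained sums form a Minkowski sum of compact sets. Compactness is what later turns
  arbitrarily close approaches to the target into a hit.\<close>

lemma compact_sum_PiE:
  fixes f :: "'k \<Rightarrow> 't \<Rightarrow> 'v::real_normed_vector"
  assumes "finite I" "\<And>k. k \<in> I \<Longrightarrow> compact (f k ` J k)"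
  shows "compact ((\<lambda>t. \<Sum>k\<in>I. f k (t k)) ` PiE I J)"
  using assms
proof (induction I rule: finite_induct)
  case (insert i I)
  have upd: "(\<Sum>k\<in>insert i I. f k ((t(i := s)) k)) = f i s + (\<Sum>k\<in>I. f k (t k))" for t s
    using insert.hyps by (auto intro!: sum.cong)
  have "(\<lambda>t. \<Sum>k\<in>insert i I. f k (t k)) ` PiE (insert i I) J
      = {x + y | x y. x \<in> f i ` J i \<and> y \<in> (\<lambda>t. \<Sum>k\<in>I. f k (t k)) ` PiE I J}"
  proof -
    have "(\<lambda>t. \<Sum>k\<in>insert i I. f k (t k)) ` PiE (insert i I) J
        = (\<lambda>(s, t). f i s + (\<Sum>k\<in>I. f k (t k))) ` (J i \<times> PiE I J)"
      unfolding PiE_insert_eq image_image case_prod_beta' upd ..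
    also have "\<dots> = {x + y | x y. x \<in> f i ` J i \<and> y \<in> (\<lambda>t. \<Sum>k\<in>I. f k (t k)) ` PiE I J}"
      by (fastforce simp: image_iff)
    finally show ?thesis .
  qed
  then show ?case using insert by (auto intro!: compact_sums)
qed simp

text \<open>Written as a Minkowski sum, it is closed for closed \<open>S\<close> (closed plus
  compact), and a point comes with the vector of the ball that must accompany its cone.\<close>

definition thickening :: "real \<Rightarrow> 'v::real_normed_vector set \<Rightarrow> 'v set" where
  "thickening \<delta> S = (\<Union>x\<in>S. \<Union>y\<in>cball 0 \<delta>. {x + y})"

lemma thickening_iff: "z \<in> thickening \<delta> S \<longleftrightarrow> (\<exists>x\<in>S. dist x z \<le> \<delta>)"
proof
  assume "z \<in> thickening \<delta> S"
  then show "\<exists>x\<in>S. dist x z \<le> \<delta>"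
    by (auto simp: thickening_def dist_norm intro!: bexI)
next
  assume "\<exists>x\<in>S. dist x z \<le> \<delta>"
  then obtain x where "x \<in> S" "dist x z \<le> \<delta>" by auto
  then show "z \<in> thickening \<delta> S"
    unfolding thickening_def
    by (intro UN_I[of x] UN_I[of "z - x"]) (auto simp: dist_norm norm_minus_commute)
qed

lemma closed_thickening:
  fixes S :: "'v::euclidean_space set"
  shows "closed S \<Longrightarrow> closed (thickening \<delta> S)"
  unfolding thickening_def by (intro closed_compact_sums compact_cball)

lemma thickening_mono: "\<delta> \<le> \<delta>' \<Longrightarrow> thickening \<delta> S \<subseteq> thickening \<delta>' S"
  by (force simp: thickening_iff)

lemma Inter_thickening:
  assumes "closed S"
  shows "(\<Inter>p. thickening (inverse (real (Suc p))) S) = S"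
proof (intro equalityI subsetI)
  fix x assume x: "x \<in> (\<Inter>p. thickening (inverse (real (Suc p))) S)"
  have "\<exists>y\<in>S. dist y x < d" if "0 < d" for d
  proof -
    obtain p where "inverse (real (Suc p)) < d" using reals_Archimedean[OF \<open>0 < d\<close>] by auto
    moreover obtain y where "y \<in> S" "dist y x \<le> inverse (real (Suc p))"
      using x by (auto simp: thickening_iff)
    ultimately show ?thesis by (auto intro: le_less_trans)
  qed
  then show "x \<in> S" using closed_approachable[OF assms, of x] by blast
qed (auto simp: thickening_iff intro!: bexI)

text \<open>For \<open>m = 0\<close> division by zero collapses the grid to \<open>{0}\<close>, so
  limits below run along \<open>Suc m\<close>.\<close>

definition grid :: "real \<Rightarrow> nat \<Rightarrow> real set" where
  "grid T m = (\<lambda>j. real j * (T / real m)) ` {..m}"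

lemma grid_subset: "0 \<le> T \<Longrightarrow> 0 < m \<Longrightarrow> grid T m \<subseteq> {0..T}"
  by (auto simp: grid_def field_simps mult_left_mono)

lemma ex_grid_close:
  assumes "0 < T" "t \<in> {0..T}" "0 < m"
  shows "\<exists>s\<in>grid T m. \<bar>s - t\<bar> \<le> T / real m"
proof -
  define x where "x = t * real m / T"
  have x: "0 \<le> x" "x \<le> real m" using assms by (auto simp: x_def field_simps)
  define j where "j = nat \<lfloor>x\<rfloor>"
  have j: "real j \<le> x" "x \<le> real j + 1"
    using x unfolding j_def by linarith+
  have "j \<le> m" using j(1) x(2) by linarith
  moreover have "\<bar>real j * (T / real m) - t\<bar> \<le> T / real m"
  proof -
    have "real j * (T / real m) - t = (real j - x) * (T / real m)"
      using assms by (simp add: x_def field_simps)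
    moreover have "\<bar>real j - x\<bar> \<le> 1" using j by linarith
    then have "\<bar>real j - x\<bar> * (T / real m) \<le> 1 * (T / real m)"
      using assms by (intro mult_right_mono) auto
    ultimately show ?thesis
      using assms by (simp add: abs_mult)
  qed
  ultimately show ?thesis by (auto simp: grid_def)
qed

lemma eventually_grid_sum_close:
  fixes f :: "'k \<Rightarrow> real \<Rightarrow> 'v::real_normed_vector"
  assumes "finite I" and T: "\<And>k. k \<in> I \<Longrightarrow> 0 < T k"
    and cont: "\<And>k. k \<in> I \<Longrightarrow> continuous_on {0..T k} (f k)"
    and t: "t \<in> (\<Pi>\<^sub>E k\<in>I. {0..T k})" and "0 < \<delta>"
  shows "\<forall>\<^sub>F m in sequentially. \<exists>s\<in>(\<Pi>\<^sub>E k\<in>I. grid (T k) (Suc m)).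
    dist (\<Sum>k\<in>I. f k (t k)) (\<Sum>k\<in>I. f k (s k)) \<le> \<delta>"
proof -
  \<comment> \<open>Each summand gets an equal share of the error; the added 1 covers an empty
    \<open>I\<close>.\<close>
  define \<eta> where "\<eta> = \<delta> / (real (card I) + 1)"
  have \<eta>: "\<eta> > 0" "real (card I) * \<eta> \<le> \<delta>" using \<open>0 < \<delta>\<close> by (auto simp: \<eta>_def field_simps)
  have "\<forall>\<^sub>F m in sequentially. \<exists>s\<in>grid (T k) (Suc m). dist (f k (t k)) (f k s) \<le> \<eta>" if k: "k \<in> I" for k
  proof -
    have tk: "t k \<in> {0..T k}" using t k by auto
    obtain d where "d > 0" and d: "\<And>s. s \<in> {0..T k} \<Longrightarrow> dist s (t k) < d \<Longrightarrow> dist (f k s) (f k (t k)) < \<eta>"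
      using cont[OF k] tk \<eta>(1) unfolding continuous_on_iff by blast
    have "(\<lambda>m. T k / real (Suc m)) \<longlonglongrightarrow> 0" by (rule LIMSEQ_Suc) (rule lim_const_over_n)
    then have "\<forall>\<^sub>F m in sequentially. T k / real (Suc m) < d"
      using \<open>d > 0\<close> by (rule order_tendstoD)
    then show ?thesis
    proof eventually_elim
      case (elim m)
      obtain s where s: "s \<in> grid (T k) (Suc m)" "\<bar>s - t k\<bar> \<le> T k / real (Suc m)"
        using ex_grid_close[OF T[OF k] tk, of "Suc m"] by auto
      moreover have "s \<in> {0..T k}" using s grid_subset[of "T k" "Suc m"] T[OF k] by auto
      ultimately show ?case
        using elim d[of s] by (intro bexI[of _ s]) (auto simp: dist_real_def dist_commute)
    qed
  qed
  then have "\<forall>\<^sub>F m in sequentially. \<forall>k\<in>I. \<exists>s\<in>grid (T k) (Suc m). dist (f k (t k)) (f k s) \<le> \<eta>"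
    using \<open>finite I\<close> by (simp add: eventually_ball_finite_distrib)
  then show ?thesis
  proof eventually_elim
    case (elim m)
    then obtain s where s: "\<And>k. k \<in> I \<Longrightarrow> s k \<in> grid (T k) (Suc m) \<and> dist (f k (t k)) (f k (s k)) \<le> \<eta>"
      by metis
    have "dist (\<Sum>k\<in>I. f k (t k)) (\<Sum>k\<in>I. f k (restrict s I k)) = norm (\<Sum>k\<in>I. f k (t k) - f k (s k))"
      by (simp add: dist_norm sum_subtractf)
    also have "\<dots> \<le> (\<Sum>k\<in>I. \<eta>)" using s by (intro sum_norm_le) (auto simp: dist_norm)
    also have "\<dots> \<le> \<delta>" using \<eta> by simp
    finally show ?case using s by (intro bexI[of _ "restrict s I"]) auto
  qed
qed

text \<open>The event asks for one of uncountably many time tuples, so its measurability is not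
  evident. It agrees almost surely with a measurable one: every thickening is hit along all
  sufficiently fine grids. Exceptional paths form a null set, which the completion absorbs, and the
  bound passes to the limit.\<close>

lemma (in prob_space) continuous_hitting_le:
  fixes X :: "'k \<Rightarrow> real \<Rightarrow> 'a \<Rightarrow> 'v::euclidean_space"
  assumes "finite I" and T: "\<And>k. k \<in> I \<Longrightarrow> 0 < T k"
    and X: "\<And>k t. k \<in> I \<Longrightarrow> 0 \<le> t \<Longrightarrow> X k t \<in> borel_measurable M"
    and cont: "AE \<omega> in M. \<forall>k\<in>I. continuous_on {0..T k} (\<lambda>t. X k t \<omega>)"
    and "closed S"
    and le: "\<And>\<delta> m. 0 < \<delta> \<Longrightarrow> 0 < m \<Longrightarrow>
      K * emeasure M {\<omega> \<in> space M. \<exists>t\<in>(\<Pi>\<^sub>E k\<in>I. grid (T k) m). (\<Sum>k\<in>I. X k (t k) \<omega>) \<in> thickening \<delta> S}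
        \<le> emeasure M {\<omega> \<in> space M. (\<Sum>k\<in>I. X k (T k) \<omega>) \<in> thickening \<delta> S}"
  defines "hit \<equiv> {\<omega> \<in> space M. \<exists>t\<in>(\<Pi>\<^sub>E k\<in>I. {0..T k}). (\<Sum>k\<in>I. X k (t k) \<omega>) \<in> S}"
  shows "hit \<in> sets (completion M)"
    and "K * emeasure (completion M) hit \<le> emeasure M {\<omega> \<in> space M. (\<Sum>k\<in>I. X k (T k) \<omega>) \<in> S}"
proof -
  define U where "U = (\<lambda>p. thickening (inverse (real (Suc p))) S)"
  have U [measurable]: "U p \<in> sets borel" for p
    using closed_thickening[OF \<open>closed S\<close>] by (auto simp: U_def)
  define fin where "fin = (\<lambda>V. {\<omega> \<in> space M. (\<Sum>k\<in>I. X k (T k) \<omega>) \<in> V})"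
  define E where "E = (\<lambda>p m. {\<omega> \<in> space M.
    \<exists>t\<in>(\<Pi>\<^sub>E k\<in>I. grid (T k) (Suc m)). (\<Sum>k\<in>I. X k (t k) \<omega>) \<in> U p})"
  \<comment> \<open>Grids for successive \<open>m\<close> are not nested, so \<open>E p m\<close>
    need not grow with \<open>m\<close>. The limit inferior is an increasing union of tails, each
    contained in a single \<open>E p m\<close>, where the assumed bound holds.\<close>
  define L where "L = (\<lambda>p. \<Union>m\<^sub>0. \<Inter>m\<in>{m\<^sub>0..}. E p m)"
  define H where "H = (\<Inter>p. L p)"
  have grid: "grid (T k) (Suc m) \<subseteq> {0..T k}" if "k \<in> I" for k m
    using grid_subset[of "T k" "Suc m"] T[OF that] by simp
  have sumX: "(\<lambda>\<omega>. \<Sum>k\<in>I. X k (t k) \<omega>) \<in> borel_measurable M" if "\<And>k. k \<in> I \<Longrightarrow> 0 \<le> t k" for t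
    using X that by (intro borel_measurable_sum) auto
  have fin: "fin V \<in> sets M" if "V \<in> sets borel" for V
    unfolding fin_def using sumX[of T] T that by (simp add: less_imp_le)
  have E [measurable]: "E p m \<in> sets M" for p m
    unfolding E_def
  proof (rule sets.sets_Collect_finite_Ex)
    show "finite (\<Pi>\<^sub>E k\<in>I. grid (T k) (Suc m))"
      using \<open>finite I\<close> by (intro finite_PiE) (auto simp: grid_def)
    show "{\<omega> \<in> space M. (\<Sum>k\<in>I. X k (t k) \<omega>) \<in> U p} \<in> sets M" if "t \<in> (\<Pi>\<^sub>E k\<in>I. grid (T k) (Suc m))" for t
    proof -
      have "0 \<le> t k" if "k \<in> I" for k
        using \<open>t \<in> _\<close> grid[OF that] that by (force simp: PiE_iff)
      then show ?thesis using sumX[of t] by measurable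
    qed
  qed
  have E_tail: "(\<Inter>m\<in>{m\<^sub>0..}. E p m) \<in> sets M" for p m\<^sub>0
    by (intro sets.countable_INT') auto
  have L: "L p \<in> sets M" for p
    unfolding L_def using E_tail by (intro sets.countable_UN) auto
  have H: "H \<in> sets M"
    unfolding H_def using L by (intro sets.countable_INT) auto
  have KL: "K * emeasure M (L p) \<le> emeasure M (fin (U p))" for p
  proof -
    have "emeasure M (L p) = (SUP m\<^sub>0. emeasure M (\<Inter>m\<in>{m\<^sub>0..}. E p m))"
      unfolding L_def
      using E_tail by (intro SUP_emeasure_incseq[symmetric]) (auto simp: incseq_def)
    then have "K * emeasure M (L p) = (SUP m\<^sub>0. K * emeasure M (\<Inter>m\<in>{m\<^sub>0..}. E p m))"
      by (simp add: SUP_mult_left_ennreal)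
    also have "\<dots> \<le> emeasure M (fin (U p))"
    proof (rule SUP_least)
      fix m\<^sub>0
      have "K * emeasure M (\<Inter>m\<in>{m\<^sub>0..}. E p m) \<le> K * emeasure M (E p m\<^sub>0)"
        by (intro mult_left_mono emeasure_mono) auto
      also have "\<dots> \<le> emeasure M (fin (U p))"
        unfolding E_def fin_def U_def by (rule le) simp_all
      finally show "K * emeasure M (\<Inter>m\<in>{m\<^sub>0..}. E p m) \<le> emeasure M (fin (U p))" .
    qed
    finally show ?thesis .
  qed
  have "K * emeasure M H \<le> (INF p. emeasure M (fin (U p)))"
  proof (rule INF_greatest)
    fix p
    have "K * emeasure M H \<le> K * emeasure M (L p)"
      using L by (intro mult_left_mono emeasure_mono) (auto simp: H_def)
    then show "K * emeasure M H \<le> emeasure M (fin (U p))" using KL by (rule order_trans)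
  qed
  \<comment> \<open>Continuity from above: the thickenings shrink as \<open>p\<close> grows, and the
    measure is finite.\<close>
  also have "\<dots> = emeasure M (\<Inter>p. fin (U p))"
  proof (rule INF_emeasure_decseq)
    have "U q \<subseteq> U p" if "p \<le> q" for p q
      unfolding U_def using that by (intro thickening_mono) (simp add: field_simps)
    then show "decseq (\<lambda>p. fin (U p))" by (auto simp: decseq_def fin_def)
  qed (auto simp: fin)
  also have "(\<Inter>p. fin (U p)) = fin S"
    using Inter_thickening[OF \<open>closed S\<close>] by (auto simp: fin_def U_def)
  finally have KH: "K * emeasure M H \<le> emeasure M (fin S)" .
  have AE_eq: "AE \<omega> in M. \<omega> \<in> hit \<longleftrightarrow> \<omega> \<in> H"
    using cont AE_space
  proof eventually_elim
    case (elim \<omega>)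
    note cont_\<omega> = elim(1)
    show ?case
    proof
      assume "\<omega> \<in> hit"
      then obtain t where t: "t \<in> (\<Pi>\<^sub>E k\<in>I. {0..T k})" "(\<Sum>k\<in>I. X k (t k) \<omega>) \<in> S"
        by (auto simp: hit_def)
      \<comment> \<open>Continuity at the hitting times brings the sum at nearby grid times within
        the thickening radius.\<close>
      have "\<omega> \<in> L p" for p
      proof -
        have "\<forall>\<^sub>F m in sequentially. \<exists>s\<in>(\<Pi>\<^sub>E k\<in>I. grid (T k) (Suc m)).
            dist (\<Sum>k\<in>I. X k (t k) \<omega>) (\<Sum>k\<in>I. X k (s k) \<omega>) \<le> inverse (real (Suc p))"
          using \<open>finite I\<close> T t(1) cont_\<omega> by (intro eventually_grid_sum_close) auto
        then have "\<forall>\<^sub>F m in sequentially. \<omega> \<in> E p m"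
          by eventually_elim (use t(2) elim(2) in \<open>auto simp: E_def U_def thickening_iff\<close>)
        then show ?thesis by (auto simp: L_def eventually_sequentially)
      qed
      then show "\<omega> \<in> H" by (simp add: H_def)
    next
      assume "\<omega> \<in> H"
      \<comment> \<open>If this compact set missed the closed \<open>S\<close>, it would keep a
        distance \<open>d\<close> > 0 from it, against the approximate hit at a level
        \<open>p\<close> with 1 / (p + 1) < d.\<close>
      define C where "C = (\<lambda>t. \<Sum>k\<in>I. X k (t k) \<omega>) ` (\<Pi>\<^sub>E k\<in>I. {0..T k})"
      have "compact C"
        unfolding C_def using \<open>finite I\<close> cont_\<omega>
        by (intro compact_sum_PiE compact_continuous_image compact_Icc) auto
      have "C \<inter> S \<noteq> {}"
      proof
        assume "C \<inter> S = {}"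
        with separate_compact_closed[OF \<open>compact C\<close> \<open>closed S\<close>]
        obtain d where "d > 0" and d: "\<And>x y. x \<in> C \<Longrightarrow> y \<in> S \<Longrightarrow> d \<le> dist x y" by auto
        obtain p where p: "inverse (real (Suc p)) < d" using reals_Archimedean[OF \<open>d > 0\<close>] by auto
        have "\<omega> \<in> L p" using \<open>\<omega> \<in> H\<close> by (simp add: H_def)
        then obtain m where "\<omega> \<in> E p m" by (auto simp: L_def)
        then obtain t where t: "t \<in> (\<Pi>\<^sub>E k\<in>I. grid (T k) (Suc m))" "(\<Sum>k\<in>I. X k (t k) \<omega>) \<in> U p"
          by (auto simp: E_def)
        have "t \<in> (\<Pi>\<^sub>E k\<in>I. {0..T k})"
          using t(1) grid by (intro subsetD[OF PiE_mono t(1)])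
        then have "(\<Sum>k\<in>I. X k (t k) \<omega>) \<in> C" by (auto simp: C_def)
        moreover obtain y where "y \<in> S" "dist y (\<Sum>k\<in>I. X k (t k) \<omega>) \<le> inverse (real (Suc p))"
          using t(2) by (auto simp: U_def thickening_iff)
        ultimately show False using d p by (force simp: dist_commute)
      qed
      then show "\<omega> \<in> hit" using elim(2) by (auto simp: hit_def C_def)
    qed
  qed
  then obtain N where N: "N \<in> null_sets M" "\<And>\<omega>. \<omega> \<in> space M - N \<Longrightarrow> \<omega> \<in> hit \<longleftrightarrow> \<omega> \<in> H"
    by (auto elim!: AE_E3)
  \<comment> \<open>A measurable set plus a subset of a null set is the shape in which membership in
    the completion is shown.\<close>
  have "hit = (H - N) \<union> (hit \<inter> N)"
    using N(2) sets.sets_into_space[OF H] by (auto simp: hit_def)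
  then show hit: "hit \<in> sets (completion M)"
    using H N by (intro sets_completionI[of _ "H - N" "hit \<inter> N" N]) auto
  have "emeasure (completion M) hit = emeasure (completion M) H"
    using hit H AE_completion[OF AE_eq] by (intro emeasure_eq_AE) auto
  also have "\<dots> = emeasure M H" using H by simp
  finally show "K * emeasure (completion M) hit \<le> emeasure M {\<omega> \<in> space M. (\<Sum>k\<in>I. X k (T k) \<omega>) \<in> S}"
    using KH by (simp add: fin_def)
qed

subsection \<open>The drift constant and the cone condition\<close>

context brownian_motion
begin

lemma cone_stable_borel: "cone_stable A T e F \<Longrightarrow> F \<in> sets borel"
  by (simp add: cone_stable_def)

text \<open>If x + q lies in \<open>F\<close>, the set \<open>W\<close> attached to x + q also
  serves x, since adding an element of \<open>W\<close> keeps the sum in the same translate.\<close>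

lemma cone_stable_translates:
  assumes F: "cone_stable A T e F" and "finite Q"
  shows "cone_stable A T e {x. \<exists>q\<in>Q. x + q \<in> F}"
  unfolding cone_stable_def
proof
  have [measurable]: "F \<in> sets borel" using F by (simp add: cone_stable_def)
  have "{x \<in> space borel. \<exists>q\<in>Q. x + q \<in> F} \<in> sets borel"
  proof (intro sets.sets_Collect_finite_Ex \<open>finite Q\<close>)
    show "{x \<in> space borel. x + q \<in> F} \<in> sets borel" for q by measurable
  qed
  then show "{x. \<exists>q\<in>Q. x + q \<in> F} \<in> sets borel" by simp
  show "\<forall>x\<in>{x. \<exists>q\<in>Q. x + q \<in> F}. \<exists>W\<in>sets borel.
      (\<forall>w\<in>W. x + w \<in> {x. \<exists>q\<in>Q. x + q \<in> F}) \<and>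
      (\<forall>r\<ge>sqrt 2. e \<le> measure M {\<omega> \<in> space M. (A *v B T \<omega>) /\<^sub>R r \<in> W})"
  proof safe
    fix x q assume "q \<in> Q" "x + q \<in> F"
    with F obtain W where W: "W \<in> sets borel" "\<And>w. w \<in> W \<Longrightarrow> x + q + w \<in> F"
      "\<And>r. r \<ge> sqrt 2 \<Longrightarrow> e \<le> measure M {\<omega> \<in> space M. (A *v B T \<omega>) /\<^sub>R r \<in> W}"
      unfolding cone_stable_def by blast
    have "\<exists>q\<in>Q. x + w + q \<in> F" if "w \<in> W" for w
      using W(2)[OF that] \<open>q \<in> Q\<close> by (auto simp: add_ac intro!: bexI[of _ q])
    then show "\<exists>W\<in>sets borel. (\<forall>w\<in>W. x + w \<in> {x. \<exists>q\<in>Q. x + q \<in> F}) \<and>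
        (\<forall>r\<ge>sqrt 2. e \<le> measure M {\<omega> \<in> space M. (A *v B T \<omega>) /\<^sub>R r \<in> W})"
      using W by (intro bexI[of _ W]) auto
  qed
qed

text \<open>A point of the thickening is u x + y with x in \<open>S\<close>; adding u (V - x) leads
  into u V + y, still in the thickening. The scalings combine to C = r u > 1, and the cone property
  V - x \<subseteq> C (V - x) turns the bound for V - x into one for u (V - x) after division by
  r.\<close>

lemma cone_stable_thickening:
  assumes cone: "cone_condition_with M (\<lambda>t \<omega>. A *v B t \<omega>) S \<epsilon>"
    and "closed S" "1 \<le> u" "0 < T"
  shows "cone_stable A T (\<epsilon> T) (thickening \<delta> ((*\<^sub>R) u ` S))"
  unfolding cone_stable_def
proof
  show "thickening \<delta> ((*\<^sub>R) u ` S) \<in> sets borel"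
    using \<open>closed S\<close> by (intro borel_closed closed_thickening closed_scaling)
  show "\<forall>x\<in>thickening \<delta> ((*\<^sub>R) u ` S). \<exists>W\<in>sets borel.
      (\<forall>w\<in>W. x + w \<in> thickening \<delta> ((*\<^sub>R) u ` S)) \<and>
      (\<forall>r\<ge>sqrt 2. \<epsilon> T \<le> measure M {\<omega> \<in> space M. (A *v B T \<omega>) /\<^sub>R r \<in> W})"
  proof
    fix z assume "z \<in> thickening \<delta> ((*\<^sub>R) u ` S)"
    then obtain x y where x: "x \<in> S" and y: "y \<in> cball 0 \<delta>" and z: "z = u *\<^sub>R x + y"
      by (auto simp: thickening_def)
    obtain V where V: "V \<in> sets borel" "V \<subseteq> S"
      and V_cone: "\<And>C. C > 1 \<Longrightarrow> (\<lambda>v. v - x) ` V \<subseteq> (*\<^sub>R) C ` (\<lambda>v. v - x) ` V"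
      and V_meas: "\<epsilon> T \<le> measure M {\<omega> \<in> space M. A *v B T \<omega> \<in> (\<lambda>v. v - x) ` V}"
      using cone x \<open>0 < T\<close> unfolding cone_condition_with_def by blast
    \<comment> \<open>This is u (V - x), written as a preimage so that it is visibly Borel.\<close>
    define W where "W = {w. x + w /\<^sub>R u \<in> V}"
    have W: "W \<in> sets borel"
    proof -
      have "(\<lambda>w. x + w /\<^sub>R u) \<in> borel_measurable borel" by measurable
      then show ?thesis using measurable_sets[of _ borel borel V] V(1) by (auto simp: W_def vimage_def)
    qed
    have "z + w \<in> thickening \<delta> ((*\<^sub>R) u ` S)" if "w \<in> W" for w
    proof -
      have "u *\<^sub>R (x + w /\<^sub>R u) \<in> (*\<^sub>R) u ` S" using that V(2) by (auto simp: W_def)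
      moreover have "z + w = u *\<^sub>R (x + w /\<^sub>R u) + y"
        using \<open>1 \<le> u\<close> by (simp add: z scaleR_add_right)
      ultimately show ?thesis using y unfolding thickening_def by blast
    qed
    moreover have "\<epsilon> T \<le> measure M {\<omega> \<in> space M. (A *v B T \<omega>) /\<^sub>R r \<in> W}" if "r \<ge> sqrt 2" for r
    proof -
      have "sqrt 2 > 1" by simp
      then have r: "r > 1" using that by linarith
      then have C: "r * u > 1" using mult_left_mono[OF \<open>1 \<le> u\<close>, of r] by linarith
      have "(A *v v) /\<^sub>R r \<in> W" if v: "A *v v \<in> (\<lambda>v. v - x) ` V" for v
      proof -
        obtain v' where v': "v' \<in> V" "A *v v = (r * u) *\<^sub>R (v' - x)"
          using subsetD[OF V_cone[OF C] v] by auto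
        have "((A *v v) /\<^sub>R r) /\<^sub>R u = v' - x"
        proof -
          have "r \<noteq> 0" "u \<noteq> 0" using r \<open>1 \<le> u\<close> by auto
          then have "inverse u * (inverse r * (r * u)) = 1" by (simp add: field_simps)
          then show ?thesis by (simp add: v'(2))
        qed
        then show ?thesis using v'(1) by (simp add: W_def)
      qed
      moreover have "{\<omega> \<in> space M. (A *v B T \<omega>) /\<^sub>R r \<in> W} \<in> sets M"
      proof -
        have "B T \<in> borel_measurable M" using \<open>0 < T\<close> by (intro borel_measurable_motion) simp
        then show ?thesis using W by measurable
      qed
      ultimately have "measure M {\<omega> \<in> space M. A *v B T \<omega> \<in> (\<lambda>v. v - x) ` V}
          \<le> measure M {\<omega> \<in> space M. (A *v B T \<omega>) /\<^sub>R r \<in> W}"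
        by (intro finite_measure_mono) auto
      with V_meas show ?thesis by linarith
    qed
    ultimately show "\<exists>W\<in>sets borel. (\<forall>w\<in>W. z + w \<in> thickening \<delta> ((*\<^sub>R) u ` S)) \<and>
      (\<forall>r\<ge>sqrt 2. \<epsilon> T \<le> measure M {\<omega> \<in> space M. (A *v B T \<omega>) /\<^sub>R r \<in> W})"
      using W by blast
  qed
qed

text \<open>With covariance T A A^T the factor T in the exponent cancels, and the square root in the
  quotient contributes the denominator T - t: exactly the exponential in the Gaussian comparison
  with shift A^(-1) (c T - c t).\<close>

lemma drift_constant_eq:
  fixes A :: "real ^ 'd ^ 'd"
  assumes "invertible A" "0 < T"
  shows "drift_constant M (\<lambda>t \<omega>. A *v B t \<omega>) c T =
    (INF t\<in>{0..<T}. exp (- (norm (matrix_inv A *v (c T - c t)))\<^sup>2 / (T - t)))"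
proof -
  have "- T * (q \<bullet> (matrix_inv (covariance_matrix M (\<lambda>\<omega>. A *v B T \<omega>)) *v q))
      = - (norm (matrix_inv A *v q))\<^sup>2" for q
    using scaled_gram_inverse_quadratic_form[OF assms, of q]
    by (simp add: covariance_matrix_linear_image[OF assms(2)])
  moreover have "(norm (matrix_inv A *v ((c T - c t) /\<^sub>R sqrt (T - t))))\<^sup>2
      = (norm (matrix_inv A *v (c T - c t)))\<^sup>2 / (T - t)" if "t < T" for t
    using that by (simp add: matrix_vector_mult_scaleR power_mult_distrib power_inverse divide_inverse)
  ultimately show ?thesis
    by (simp add: drift_constant_def Let_def)
qed

lemma drift_constant_le:
  fixes A :: "real ^ 'd ^ 'd"
  assumes "invertible A" "0 \<le> t" "t < T"
  shows "drift_constant M (\<lambda>t \<omega>. A *v B t \<omega>) c T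
    \<le> exp (- (norm (matrix_inv A *v (c T - c t)))\<^sup>2 / (T - t))"
proof (subst drift_constant_eq)
  show "(INF t\<in>{0..<T}. exp (- (norm (matrix_inv A *v (c T - c t)))\<^sup>2 / (T - t)))
      \<le> exp (- (norm (matrix_inv A *v (c T - c t)))\<^sup>2 / (T - t))"
    using assms by (intro cINF_lower bdd_belowI2[of _ 0]) auto
qed (use assms in auto)

text \<open>Order sqrt (T - t) in the drift is what keeps the squared norm divided by T - t bounded
  as t tends to \<open>T\<close>, so the exponents have a common lower bound.\<close>

lemma drift_constant_pos:
  fixes A :: "real ^ 'd ^ 'd"
  assumes "invertible A" "0 < T"
    and c: "\<And>t i. t \<in> {0..T} \<Longrightarrow> \<bar>c t $ i - c T $ i\<bar> \<le> K * sqrt \<bar>t - T\<bar>"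
  shows "0 < drift_constant M (\<lambda>t \<omega>. A *v B t \<omega>) c T"
proof -
  define L where "L = onorm ((*v) (matrix_inv A))"
  \<comment> \<open>\<open>L\<close> is the operator norm of the inverse matrix; the dimension
    enters by bounding the norm of the drift by the sum of its components.\<close>
  define R where "R = (L * (real CARD('d) * K))\<^sup>2"
  have "exp (- R) \<le> exp (- (norm (matrix_inv A *v (c T - c t)))\<^sup>2 / (T - t))" if t: "t \<in> {0..<T}" for t
  proof -
    have "norm (c T - c t) \<le> (\<Sum>i\<in>UNIV. \<bar>(c T - c t) $ i\<bar>)" by (rule norm_le_l1_cart)
    also have "\<dots> \<le> (\<Sum>i\<in>(UNIV :: 'd set). K * sqrt (T - t))"
      using c[of t] t by (intro sum_mono) (auto simp: abs_minus_commute)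
    finally have n: "norm (c T - c t) \<le> real CARD('d) * K * sqrt (T - t)" by simp
    have "norm (matrix_inv A *v (c T - c t)) \<le> L * norm (c T - c t)"
      unfolding L_def by (rule onorm) (rule matrix_vector_mul_bounded_linear)
    also have "\<dots> \<le> L * (real CARD('d) * K * sqrt (T - t))"
      using n by (intro mult_left_mono) (auto simp: L_def intro: onorm_pos_le matrix_vector_mul_bounded_linear)
    finally have "(norm (matrix_inv A *v (c T - c t)))\<^sup>2 \<le> (L * (real CARD('d) * K * sqrt (T - t)))\<^sup>2"
      by (intro power_mono) auto
    also have "\<dots> = R * (T - t)" using t by (simp add: R_def power_mult_distrib)
    finally show ?thesis using t by (simp add: field_simps)
  qed
  then have "exp (- R) \<le> drift_constant M (\<lambda>t \<omega>. A *v B t \<omega>) c T"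
    unfolding drift_constant_eq[OF assms(1,2)] using \<open>0 < T\<close> by (intro cINF_greatest) auto
  then show ?thesis using exp_gt_zero[of "- R"] by linarith
qed

section \<open>From one process to independent copies\<close>

lemma measurable_path:
  assumes "\<And>t. 0 \<le> t \<Longrightarrow> X t \<in> borel_measurable M"
  shows "path X \<in> M \<rightarrow>\<^sub>M path_space"
  unfolding path_def path_space_def using assms by (intro measurable_restrict) auto

text \<open>A grid event involves finitely many times, so it is measurable on path space and its
  probability depends only on the joint law. Independence and equality in law make this a power of
  the law of \<open>Z\<close>, to which the coordinatewise exchange applies; its one-coordinate
  bound is the first-hitting estimate transported to path space.\<close>

lemma indep_copies_grid_hitting_le:
  fixes Zs :: "'k \<Rightarrow> real \<Rightarrow> 'a \<Rightarrow> real ^ 'd"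
  assumes A: "invertible A" and copies: "indep_copies M (\<lambda>t \<omega>. A *v B t \<omega>) I Zs"
    and I: "finite I" "I \<noteq> {}" and T: "\<And>k. k \<in> I \<Longrightarrow> 0 < T k"
    and D: "\<And>k. k \<in> I \<Longrightarrow> 0 \<le> drift_constant M (\<lambda>t \<omega>. A *v B t \<omega>) (c k) (T k)"
    and F: "\<And>k. k \<in> I \<Longrightarrow> cone_stable A (T k) (\<epsilon> (T k)) F" and "0 < m"
  shows "(\<Prod>k\<in>I. ennreal (drift_constant M (\<lambda>t \<omega>. A *v B t \<omega>) (c k) (T k) * \<epsilon> (T k) / 2 powr (real CARD('d) / 2)))
      * emeasure M {\<omega> \<in> space M. \<exists>t\<in>(\<Pi>\<^sub>E k\<in>I. grid (T k) m). (\<Sum>k\<in>I. Zs k (t k) \<omega> - c k (t k)) \<in> F}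
    \<le> emeasure M {\<omega> \<in> space M. (\<Sum>k\<in>I. Zs k (T k) \<omega> - c k (T k)) \<in> F}"
proof -
  define Z where "Z = (\<lambda>t \<omega>. A *v B t \<omega>)"
  define N where "N = distr M path_space (path Z)"
  define \<kappa> where "\<kappa> = (\<lambda>k. ennreal (drift_constant M Z (c k) (T k) * \<epsilon> (T k) / 2 powr (real CARD('d) / 2)))"
  \<comment> \<open>One target must serve all processes although their end times differ, so
    stability is required at every \<open>T k\<close> simultaneously.\<close>
  define \<F> where "\<F> = {F. F \<in> sets borel \<and> (\<forall>k\<in>I. cone_stable A (T k) (\<epsilon> (T k)) F)}"
  have Z: "Z t \<in> borel_measurable M" if "0 \<le> t" for t
    unfolding Z_def using borel_measurable_motion[OF that] by measurable
  have Zpath: "path Z \<in> M \<rightarrow>\<^sub>M path_space" using Z by (rule measurable_path)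
  interpret N: prob_space N unfolding N_def using Zpath by (rule prob_space_distr)
  have sets_N [simp]: "sets N = sets path_space" "space N = space path_space"
    by (simp_all add: N_def)
  have grid: "0 \<le> t" if "t \<in> insert (T k) (grid (T k) m)" "k \<in> I" for k t
    using that grid_subset[of "T k" m] T[of k] \<open>0 < m\<close> by auto
  have eval: "(\<lambda>w. w t - v) \<in> borel_measurable N" if "0 \<le> t" for t and v :: "real ^ 'd"
  proof -
    have "(\<lambda>w. w t) \<in> borel_measurable N"
      using that by (simp add: measurable_cong_sets[OF sets_N(1) refl] path_space_def
        measurable_component_singleton)
    then show ?thesis by measurable
  qed
  have fin_grid: "finite (grid (T k) m)" for k by (simp add: grid_def)
  have main: "(\<Prod>k\<in>I. \<kappa> k) * emeasure (PiM I (\<lambda>_. N))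
      {w \<in> space (PiM I (\<lambda>_. N)). \<exists>t\<in>(\<Pi>\<^sub>E k\<in>I. grid (T k) m). (\<Sum>k\<in>I. w k (t k) - c k (t k)) \<in> F}
    \<le> emeasure (PiM I (\<lambda>_. N)) {w \<in> space (PiM I (\<lambda>_. N)). (\<Sum>k\<in>I. w k (T k) - c k (T k)) \<in> F}"
  proof (rule PiM_hitting_le[where Y = "\<lambda>k t w. w t - c k t" and \<tau> = T and \<F> = \<F>])
    show "sigma_finite_measure N" by unfold_locales
    show "{x. \<exists>q\<in>Q. x + q \<in> F} \<in> \<F>" if "F \<in> \<F>" "finite Q" for F Q
    proof -
      have "cone_stable A (T k) (\<epsilon> (T k)) {x. \<exists>q\<in>Q. x + q \<in> F}" if "k \<in> I" for k
        using \<open>F \<in> \<F>\<close> \<open>finite Q\<close> that by (intro cone_stable_translates) (auto simp: \<F>_def)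
      then show ?thesis using I(2) unfolding \<F>_def by (blast intro: cone_stable_borel)
    qed
    show "F \<in> \<F>" using F I(2) unfolding \<F>_def by (blast intro: cone_stable_borel)
    show "\<kappa> k * emeasure N {w \<in> space N. \<exists>t\<in>grid (T k) m. w t - c k t \<in> F}
        \<le> emeasure N {w \<in> space N. w (T k) - c k (T k) \<in> F}" if k: "k \<in> I" and F: "F \<in> \<F>" for k F
    proof -
      have [measurable]: "F \<in> sets borel" using F by (simp add: \<F>_def)
      have path_in: "path Z \<omega> \<in> space path_space" for \<omega>
        by (simp add: path_def path_space_def space_PiM)
      have "{w \<in> space N. w t - c k t \<in> F} \<in> sets N" if "0 \<le> t" for t
        using eval[OF that] by measurable
      then have s: "{w \<in> space N. w (T k) - c k (T k) \<in> F} \<in> sets N"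
          "{w \<in> space N. \<exists>t\<in>grid (T k) m. w t - c k t \<in> F} \<in> sets N"
        using grid[OF _ k] fin_grid by (auto intro!: sets.sets_Collect_finite_Ex)
      have "emeasure N {w \<in> space N. \<exists>t\<in>grid (T k) m. w t - c k t \<in> F}
          = emeasure M (path Z -` {w \<in> space N. \<exists>t\<in>grid (T k) m. w t - c k t \<in> F} \<inter> space M)"
        unfolding N_def using Zpath s(2) by (intro emeasure_distr) auto
      also have "path Z -` {w \<in> space N. \<exists>t\<in>grid (T k) m. w t - c k t \<in> F} \<inter> space M
          = {\<omega> \<in> space M. \<exists>j\<le>m. A *v B (real j * (T k / real m)) \<omega> - c k (real j * (T k / real m)) \<in> F}"
        using T[OF k] path_in by (auto simp: grid_def path_def Z_def)
      finally have hit: "emeasure N {w \<in> space N. \<exists>t\<in>grid (T k) m. w t - c k t \<in> F} = emeasure M \<dots>" .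
      have "emeasure N {w \<in> space N. w (T k) - c k (T k) \<in> F}
          = emeasure M (path Z -` {w \<in> space N. w (T k) - c k (T k) \<in> F} \<inter> space M)"
        unfolding N_def using Zpath s(1) by (intro emeasure_distr) auto
      also have "path Z -` {w \<in> space N. w (T k) - c k (T k) \<in> F} \<inter> space M
          = {\<omega> \<in> space M. A *v B (T k) \<omega> - c k (T k) \<in> F}"
        using T[OF k] path_in by (auto simp: path_def Z_def)
      finally show ?thesis
        unfolding hit \<kappa>_def Z_def
      proof (simp only:, intro hitting_grid_le)
        show "cone_stable A (T k) (\<epsilon> (T k)) F" using F k by (simp add: \<F>_def)
        show "A ** matrix_inv A = mat 1" using A by (rule matrix_inv_right)
        show "drift_constant M (\<lambda>t \<omega>. A *v B t \<omega>) (c k) (T k)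
            \<le> exp (- (norm (matrix_inv A *v (c k (T k) - c k t)))\<^sup>2 / (T k - t))"
          if "0 \<le> t" "t < T k" for t
          using A that by (rule drift_constant_le)
      qed (rule D[OF k] T[OF k] \<open>0 < m\<close>)+
    qed
    show "(\<lambda>w. w t - c k t) \<in> N \<rightarrow>\<^sub>M borel" if "k \<in> I" "t \<in> insert (T k) (grid (T k) m)" for k t
      using grid[OF that(2,1)] by (rule eval)
    show "F \<in> sets borel" if "F \<in> \<F>" for F using that by (simp add: \<F>_def)
  qed (rule I fin_grid)+
  have rv: "path (Zs k) \<in> M \<rightarrow>\<^sub>M path_space" if "k \<in> I" for k
    using copies that by (simp add: indep_copies_def indep_vars_def2)
  have "distr M (PiM I (\<lambda>_. path_space)) (\<lambda>\<omega>. \<lambda>k\<in>I. path (Zs k) \<omega>)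
      = PiM I (\<lambda>k. distr M path_space (path (Zs k)))"
    using copies I(2) rv indep_vars_iff_distr_eq_PiM'[where I = I and M' = "\<lambda>_. path_space" and X = "\<lambda>k. path (Zs k)"]
    by (simp add: indep_copies_def)
  also have "\<dots> = PiM I (\<lambda>_. N)"
    using copies by (intro PiM_cong) (auto simp: indep_copies_def N_def Z_def)
  finally have law: "PiM I (\<lambda>_. N) = distr M (PiM I (\<lambda>_. path_space)) (\<lambda>\<omega>. \<lambda>k\<in>I. path (Zs k) \<omega>)" ..
  have tuple: "(\<lambda>\<omega>. \<lambda>k\<in>I. path (Zs k) \<omega>) \<in> M \<rightarrow>\<^sub>M PiM I (\<lambda>_. path_space)"
    using rv by (intro measurable_restrict) auto
  have tuple_in: "(\<lambda>k\<in>I. path (Zs k) \<omega>) \<in> space (PiM I (\<lambda>_. N))" for \<omega>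
    by (auto simp: space_PiM path_def path_space_def)
  have [measurable]: "F \<in> sets borel" using F I(2) cone_stable_borel by blast
  have "(\<lambda>w. \<Sum>k\<in>I. w k (t k) - c k (t k)) \<in> borel_measurable (PiM I (\<lambda>_. N))"
    if "\<And>k. k \<in> I \<Longrightarrow> 0 \<le> t k" for t
  proof (rule borel_measurable_sum)
    fix k assume k: "k \<in> I"
    show "(\<lambda>w. w k (t k) - c k (t k)) \<in> borel_measurable (PiM I (\<lambda>_. N))"
      by (rule measurable_compose[where f = "\<lambda>w. w k" and g = "\<lambda>w. w (t k) - c k (t k)",
            OF measurable_component_singleton[OF k] eval[OF that[OF k]]])
  qed
  then have s: "{w \<in> space (PiM I (\<lambda>_. N)). (\<Sum>k\<in>I. w k (t k) - c k (t k)) \<in> F} \<in> sets (PiM I (\<lambda>_. N))"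
    if "\<And>k. k \<in> I \<Longrightarrow> 0 \<le> t k" for t
    using that by measurable
  have em: "emeasure (PiM I (\<lambda>_. N)) {w \<in> space (PiM I (\<lambda>_. N)). P w}
      = emeasure M {\<omega> \<in> space M. P (\<lambda>k\<in>I. path (Zs k) \<omega>)}"
    if "{w \<in> space (PiM I (\<lambda>_. N)). P w} \<in> sets (PiM I (\<lambda>_. N))" for P
  proof -
    have "emeasure (PiM I (\<lambda>_. N)) {w \<in> space (PiM I (\<lambda>_. N)). P w}
      = emeasure M ((\<lambda>\<omega>. \<lambda>k\<in>I. path (Zs k) \<omega>) -` {w \<in> space (PiM I (\<lambda>_. N)). P w} \<inter> space M)"
      using tuple that unfolding law by (intro emeasure_distr) auto
    also have "(\<lambda>\<omega>. \<lambda>k\<in>I. path (Zs k) \<omega>) -` {w \<in> space (PiM I (\<lambda>_. N)). P w} \<inter> space M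
      = {\<omega> \<in> space M. P (\<lambda>k\<in>I. path (Zs k) \<omega>)}"
      using tuple_in by auto
    finally show ?thesis .
  qed
  \<comment> \<open>\<open>path\<close> agrees with the process only at nonnegative times, hence the
    side condition on \<open>t\<close>.\<close>
  have path_sum: "(\<Sum>k\<in>I. (\<lambda>k\<in>I. path (Zs k) \<omega>) k (t k) - c k (t k)) = (\<Sum>k\<in>I. Zs k (t k) \<omega> - c k (t k))"
    if "\<And>k. k \<in> I \<Longrightarrow> 0 \<le> t k" for t \<omega>
    using that by (intro sum.cong) (auto simp: path_def)
  have grid_nonneg: "0 \<le> t k" if "t \<in> (\<Pi>\<^sub>E k\<in>I. grid (T k) m)" "k \<in> I" for t k
    using that grid[of "t k" k] by auto
  have "finite (\<Pi>\<^sub>E k\<in>I. grid (T k) m)" using I(1) fin_grid by (intro finite_PiE)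
  then have "emeasure (PiM I (\<lambda>_. N))
      {w \<in> space (PiM I (\<lambda>_. N)). \<exists>t\<in>(\<Pi>\<^sub>E k\<in>I. grid (T k) m). (\<Sum>k\<in>I. w k (t k) - c k (t k)) \<in> F}
    = emeasure M {\<omega> \<in> space M. \<exists>t\<in>(\<Pi>\<^sub>E k\<in>I. grid (T k) m).
        (\<Sum>k\<in>I. (\<lambda>k\<in>I. path (Zs k) \<omega>) k (t k) - c k (t k)) \<in> F}"
    using s grid_nonneg by (intro em sets.sets_Collect_finite_Ex) auto
  also have "{\<omega> \<in> space M. \<exists>t\<in>(\<Pi>\<^sub>E k\<in>I. grid (T k) m).
        (\<Sum>k\<in>I. (\<lambda>k\<in>I. path (Zs k) \<omega>) k (t k) - c k (t k)) \<in> F}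
    = {\<omega> \<in> space M. \<exists>t\<in>(\<Pi>\<^sub>E k\<in>I. grid (T k) m). (\<Sum>k\<in>I. Zs k (t k) \<omega> - c k (t k)) \<in> F}"
  proof (intro Collect_cong conj_cong bex_cong refl)
    fix \<omega> t assume "t \<in> (\<Pi>\<^sub>E k\<in>I. grid (T k) m)"
    then show "(\<Sum>k\<in>I. (\<lambda>k\<in>I. path (Zs k) \<omega>) k (t k) - c k (t k)) \<in> F
        \<longleftrightarrow> (\<Sum>k\<in>I. Zs k (t k) \<omega> - c k (t k)) \<in> F"
      by (subst path_sum) (auto dest: grid_nonneg)
  qed
  finally have hit: "emeasure (PiM I (\<lambda>_. N))
      {w \<in> space (PiM I (\<lambda>_. N)). \<exists>t\<in>(\<Pi>\<^sub>E k\<in>I. grid (T k) m). (\<Sum>k\<in>I. w k (t k) - c k (t k)) \<in> F}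
    = emeasure M {\<omega> \<in> space M. \<exists>t\<in>(\<Pi>\<^sub>E k\<in>I. grid (T k) m). (\<Sum>k\<in>I. Zs k (t k) \<omega> - c k (t k)) \<in> F}" .
  have T0: "0 \<le> T k" if "k \<in> I" for k using T[OF that] by simp
  have "emeasure (PiM I (\<lambda>_. N)) {w \<in> space (PiM I (\<lambda>_. N)). (\<Sum>k\<in>I. w k (T k) - c k (T k)) \<in> F}
    = emeasure M {\<omega> \<in> space M. (\<Sum>k\<in>I. (\<lambda>k\<in>I. path (Zs k) \<omega>) k (T k) - c k (T k)) \<in> F}"
    by (rule em) (rule s[OF T0])
  also have "\<dots> = emeasure M {\<omega> \<in> space M. (\<Sum>k\<in>I. Zs k (T k) \<omega> - c k (T k)) \<in> F}"
    by (subst path_sum[of T, OF T0]) simp_all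
  finally show ?thesis
    using main unfolding hit \<kappa>_def Z_def by simp
qed

end

theorem theorem1p4:
  fixes M :: "'a measure"
    and A :: "real ^ 'd ^ 'd"
    and B Z :: "real \<Rightarrow> 'a \<Rightarrow> real ^ 'd"
    and Zs :: "nat \<Rightarrow> real \<Rightarrow> 'a \<Rightarrow> real ^ 'd"
    and n :: nat
    and T :: "nat \<Rightarrow> real"
    and c :: "nat \<Rightarrow> real \<Rightarrow> real ^ 'd"
    and S :: "(real ^ 'd) set"
    and \<epsilon> :: "real \<Rightarrow> real"
  assumes "n \<ge> 1"
    and "invertible A"
    and "brownian_motion M B"
    and "Z = (\<lambda>t \<omega>. A *v B t \<omega>)"
    and "indep_copies M Z {1..n} Zs"
    and "\<And>k. k \<in> {1..n} \<Longrightarrow> T k > 0"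
    and "\<And>k. k \<in> {1..n} \<Longrightarrow> continuous_on {0..} (c k)"
    and "\<And>k. k \<in> {1..n} \<Longrightarrow>
           \<exists>K>0. \<forall>t\<in>{0..T k}. \<forall>i. \<bar>c k t $ i - c k (T k) $ i\<bar> \<le> K * sqrt \<bar>t - T k\<bar>"
    and "closed S" and "0 \<notin> S"
    and "cone_condition_with M Z S \<epsilon>"
  shows "(\<forall>k\<in>{1..n}. drift_constant M Z (c k) (T k) > 0) \<and>
    (\<forall>u>1.
      let final = {\<omega> \<in> space M. (\<Sum>k\<in>{1..n}. Zs k (T k) \<omega>) - (\<Sum>k\<in>{1..n}. c k (T k)) \<in> (*\<^sub>R) u ` S};
          hit = {\<omega> \<in> space M. \<exists>t \<in> (\<Pi>\<^sub>E k\<in>{1..n}. {0..T k}).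
                   (\<Sum>k\<in>{1..n}. Zs k (t k) \<omega>) - (\<Sum>k\<in>{1..n}. c k (t k)) \<in> (*\<^sub>R) u ` S}
      in hit \<in> sets (completion M) \<and>
         measure M final \<le> measure (completion M) hit \<and>
         measure (completion M) hit \<le>
           (\<Prod>k\<in>{1..n}. 2 powr (real CARD('d) / 2) / (drift_constant M Z (c k) (T k) * \<epsilon> (T k)))
             * measure M final)"
proof -
  interpret brownian_motion M B by fact
  note T = assms(6)
  let ?I = "{1..n}"
  have pos: "drift_constant M Z (c k) (T k) > 0" if "k \<in> ?I" for k
  proof -
    obtain K where "\<forall>t\<in>{0..T k}. \<forall>i. \<bar>c k t $ i - c k (T k) $ i\<bar> \<le> K * sqrt \<bar>t - T k\<bar>"
      using assms(8)[OF \<open>k \<in> ?I\<close>] by blast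
    then show ?thesis
      unfolding assms(4) using assms(2) T[OF that] by (intro drift_constant_pos) auto
  qed
  have \<epsilon>: "\<epsilon> (T k) > 0" if "k \<in> ?I" for k
    using assms(11) T[OF that] by (simp add: cone_condition_with_def)
  have "hit \<in> sets (completion M) \<and> measure M final \<le> measure (completion M) hit \<and>
      measure (completion M) hit \<le>
        (\<Prod>k\<in>?I. 2 powr (real CARD('d) / 2) / (drift_constant M Z (c k) (T k) * \<epsilon> (T k))) * measure M final"
    if "u > 1"
      and final: "final = {\<omega> \<in> space M. (\<Sum>k\<in>?I. Zs k (T k) \<omega>) - (\<Sum>k\<in>?I. c k (T k)) \<in> (*\<^sub>R) u ` S}"
      and hit: "hit = {\<omega> \<in> space M. \<exists>t \<in> (\<Pi>\<^sub>E k\<in>?I. {0..T k}).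
        (\<Sum>k\<in>?I. Zs k (t k) \<omega>) - (\<Sum>k\<in>?I. c k (t k)) \<in> (*\<^sub>R) u ` S}"
    for u final hit
  proof -
    \<comment> \<open>Putting each drift into its own process turns the event into one about a
      single sum over \<open>k\<close>.\<close>
    define X where "X = (\<lambda>k t \<omega>. Zs k t \<omega> - c k t)"
    \<comment> \<open>The reciprocal of one factor of the asserted product; positivity allows the
      division at the end.\<close>
    define \<kappa> where "\<kappa> = (\<lambda>k. drift_constant M Z (c k) (T k) * \<epsilon> (T k) / 2 powr (real CARD('d) / 2))"
    have \<kappa>: "\<kappa> k > 0" if "k \<in> ?I" for k using pos[OF that] \<epsilon>[OF that] by (simp add: \<kappa>_def)
    have final_X: "final = {\<omega> \<in> space M. (\<Sum>k\<in>?I. X k (T k) \<omega>) \<in> (*\<^sub>R) u ` S}"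
      and hit_X: "hit = {\<omega> \<in> space M. \<exists>t\<in>(\<Pi>\<^sub>E k\<in>?I. {0..T k}). (\<Sum>k\<in>?I. X k (t k) \<omega>) \<in> (*\<^sub>R) u ` S}"
      by (simp_all add: final hit X_def sum_subtractf)
    have uS: "closed ((*\<^sub>R) u ` S)" using \<open>closed S\<close> by (rule closed_scaling)
    have X: "X k t \<in> borel_measurable M" if "k \<in> ?I" "0 \<le> t" for k t
    proof -
      have "path (Zs k) \<in> M \<rightarrow>\<^sub>M path_space"
        using assms(5) \<open>k \<in> ?I\<close> by (simp add: indep_copies_def indep_vars_def2)
      moreover have "(\<lambda>w. w t) \<in> borel_measurable (path_space :: (real \<Rightarrow> real ^ 'd) measure)"
        unfolding path_space_def using \<open>0 \<le> t\<close> by (intro measurable_component_singleton) auto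
      ultimately have "(\<lambda>\<omega>. path (Zs k) \<omega> t) \<in> borel_measurable M"
        by (rule measurable_compose)
      then show ?thesis using \<open>0 \<le> t\<close> by (simp add: path_def X_def)
    qed
    have cont: "AE \<omega> in M. \<forall>k\<in>?I. continuous_on {0..T k} (\<lambda>t. X k t \<omega>)"
    proof (rule AE_finite_allI)
      fix k assume k: "k \<in> ?I"
      have "AE \<omega> in M. continuous_on {0..} (\<lambda>t. Zs k t \<omega>)"
        using assms(5) k by (simp add: indep_copies_def)
      then show "AE \<omega> in M. continuous_on {0..T k} (\<lambda>t. X k t \<omega>)"
      proof eventually_elim
        case (elim \<omega>)
        then have "continuous_on {0..} (\<lambda>t. X k t \<omega>)"
          unfolding X_def using assms(7)[OF k] by (rule continuous_on_diff)
        then show ?case by (rule continuous_on_subset) auto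
      qed
    qed simp
    have le: "(\<Prod>k\<in>?I. ennreal (\<kappa> k))
        * emeasure M {\<omega> \<in> space M. \<exists>t\<in>(\<Pi>\<^sub>E k\<in>?I. grid (T k) m).
            (\<Sum>k\<in>?I. X k (t k) \<omega>) \<in> thickening \<delta> ((*\<^sub>R) u ` S)}
      \<le> emeasure M {\<omega> \<in> space M. (\<Sum>k\<in>?I. X k (T k) \<omega>) \<in> thickening \<delta> ((*\<^sub>R) u ` S)}"
      if "0 < \<delta>" "0 < m" for \<delta> m
      unfolding X_def \<kappa>_def assms(4)
    proof (rule indep_copies_grid_hitting_le)
      show "indep_copies M (\<lambda>t \<omega>. A *v B t \<omega>) ?I Zs" using assms(4,5) by simp
      show "0 \<le> drift_constant M (\<lambda>t \<omega>. A *v B t \<omega>) (c k) (T k)" if "k \<in> ?I" for k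
        using pos[OF that] by (simp add: assms(4))
      show "cone_stable A (T k) (\<epsilon> (T k)) (thickening \<delta> ((*\<^sub>R) u ` S))" if "k \<in> ?I" for k
        using assms(4,9,11) \<open>u > 1\<close> T[OF that] by (intro cone_stable_thickening) auto
    qed (use assms(1,2) T \<open>0 < m\<close> in auto)
    note hitting = continuous_hitting_le[of ?I T X "(*\<^sub>R) u ` S" "\<Prod>k\<in>?I. ennreal (\<kappa> k)",
        OF finite_atLeastAtMost T X cont uS le, folded hit_X final_X]
    interpret C: prob_space "completion M" by (rule prob_space_completion)
    have "(\<lambda>\<omega>. \<Sum>k\<in>?I. X k (T k) \<omega>) \<in> borel_measurable M"
      using X T by (intro borel_measurable_sum) (auto simp: less_imp_le)
    then have final_sets: "final \<in> sets M"
      unfolding final_X using borel_closed[OF uS] by measurable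
    \<comment> \<open>The end times are one admissible choice; \<open>restrict\<close> is needed
      because members of \<open>\<Pi>\<^sub>E\<close> are \<open>undefined\<close> outside the index
      set.\<close>
    have "final \<subseteq> hit"
    proof
      fix \<omega> assume "\<omega> \<in> final"
      then show "\<omega> \<in> hit"
        unfolding hit_X final_X using T
        by (auto intro!: bexI[of _ "restrict T ?I"] simp: less_imp_le)
    qed
    then have "measure (completion M) final \<le> measure (completion M) hit"
      using hitting(1) by (rule C.finite_measure_mono)
    then have final_le: "measure M final \<le> measure (completion M) hit"
      using final_sets by (simp add: measure_completion)
    have prod_pos: "(\<Prod>k\<in>?I. \<kappa> k) > 0" using \<kappa> by (intro prod_pos) auto
    have "ennreal ((\<Prod>k\<in>?I. \<kappa> k) * measure (completion M) hit)
        = (\<Prod>k\<in>?I. ennreal (\<kappa> k)) * emeasure (completion M) hit"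
      using \<kappa> prod_pos by (subst prod_ennreal) (auto simp: C.emeasure_eq_measure ennreal_mult' less_imp_le
        simp del: emeasure_completion)
    also have "\<dots> \<le> ennreal (measure M final)"
      using hitting(2) unfolding emeasure_eq_measure .
    finally have "measure (completion M) hit \<le> measure M final / (\<Prod>k\<in>?I. \<kappa> k)"
      using prod_pos by (simp add: pos_le_divide_eq mult.commute)
    also have "\<dots> = (\<Prod>k\<in>?I. 2 powr (real CARD('d) / 2) / (drift_constant M Z (c k) (T k) * \<epsilon> (T k)))
        * measure M final"
      by (simp add: \<kappa>_def prod_dividef)
    finally show ?thesis using hitting(1) final_le by blast
  qed
  then show ?thesis using pos by (simp add: Let_def)
qed

end
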